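(* Let $M$ be a Coxeter matrix of finite type over a finite set $I$. For any $J\subset I$ and any $K\subset I$ we have $$p_J(w_{K;I})=w_{J\star_I K;\,J}.$$ In particular, $p_J$ maps the set $\{w_{K;I}:K\subset I\}$ into $\{w_{L;J}:L\subset J\}$, i.e. $p_J$ is a parabolic homomorphism.
   Context: A Coxeter matrix over a finite set $I$ is a symmetric matrix $M=(m_{ij})_{i,j\in I}$ with $m_{ii}=1$ and $m_{ij}\in\mathbb Z_{\ge 2}\cup\{\infty\}$ for $i\ne j$. $W(M)$ is the corresponding Coxeter group with simple generators $s_i$ and length function $\ell$; $M$ is of finite type if $W(M)$ is finite. The Hecke monoid $(W(M),\star)$ is the monoid generated by $s_i$, $i\in I$, subject to $s_i\star s_i=s_i$ and $s_i\star s_j\star s_i\star\cdots=s_j\star s_i\star s_j\star\cdots$ ($m_{ij}$ factors on each side); as a set it is identified with $W(M)$, the product being determined by $s_i\star w=s_iw$ if $\ell(s_iw)>\ell(w)$ and $s_i\star w=w$ otherwise. For $J\subset I$, $W_J(M)=\langle s_j:j\in J\rangle$ and $w_\circ^J$ is the longest element of $W_J(M)$. For $J\subset K\subset I$, $w_{J;K}=w_\circ^Jw_\circ^K$ (product in the group). The parabolic projection $p_J:(W(M),\star)\to(W_J(M),\star)$ is the homomorphism of monoids with $p_J(s_i)=s_i$ for $i\in J$ and $p_J(s_i)=1$ for $i\in I\setminus J$. It is known that for $M$ of finite type and $J,K\subset I$ there is a unique subset $J\star_IK\subset J\cap K$ such that $w_{J;I}\star w_{K;I}=w_{J\star_IK;I}$;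 this defines $J\star_I K$. *)

theory Defs
  imports "HOL-Algebra.Generated_Groups" "HOL-Library.Extended_Nat"
begin

section \<open>Monoids given by generators and relations\<close>

inductive word_cong :: "'i set \<Rightarrow> ('i list \<times> 'i list) set \<Rightarrow> 'i list \<Rightarrow> 'i list \<Rightarrow> bool"
  for A R where
  rel: "(u, v) \<in> R \<Longrightarrow> u \<in> lists A \<Longrightarrow> v \<in> lists A \<Longrightarrow> xs \<in> lists A \<Longrightarrow> ys \<in> lists A
    \<Longrightarrow> word_cong A R (xs @ u @ ys) (xs @ v @ ys)"
| refl: "xs \<in> lists A \<Longrightarrow> word_cong A R xs xs"
| sym: "word_cong A R xs ys \<Longrightarrow> word_cong A R ys xs"
| trans: "word_cong A R xs ys \<Longrightarrow> word_cong A R ys zs \<Longrightarrow> word_cong A R xs zs"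

definition word_class :: "'i set \<Rightarrow> ('i list \<times> 'i list) set \<Rightarrow> 'i list \<Rightarrow> 'i list set" where
  "word_class A R xs = {ys. word_cong A R xs ys}"

text \<open>An element of the presented monoid is the set of all words in the alphabet that represent it.\<close>

definition presented_monoid :: "'i set \<Rightarrow> ('i list \<times> 'i list) set \<Rightarrow> 'i list set monoid" where
  "presented_monoid A R =
    \<lparr>carrier = word_class A R ` lists A,
     mult = (\<lambda>X Y. \<Union>x\<in>X. \<Union>y\<in>Y. word_class A R (x @ y)),
     one = word_class A R []\<rparr>"

lemma word_cong_in_lists: "word_cong A R xs ys \<Longrightarrow> xs \<in> lists A \<and> ys \<in> lists A"
  by (induction rule: word_cong.induct) auto

lemma word_cong_append_right:
  assumes "word_cong A R xs ys" "zs \<in> lists A"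
  shows "word_cong A R (xs @ zs) (ys @ zs)"
  using assms
proof (induction rule: word_cong.induct)
  case (rel u v xs ys)
  then show ?case using word_cong.rel[of u v R A xs "ys @ zs"] by simp
next
  case (refl xs)
  then show ?case by (intro word_cong.refl) simp
qed (blast intro: word_cong.sym word_cong.trans)+

lemma word_cong_append_left:
  assumes "word_cong A R xs ys" "zs \<in> lists A"
  shows "word_cong A R (zs @ xs) (zs @ ys)"
  using assms
proof (induction rule: word_cong.induct)
  case (rel u v xs ys)
  then show ?case using word_cong.rel[of u v R A "zs @ xs" ys] by simp
next
  case (refl xs)
  then show ?case by (intro word_cong.refl) simp
qed (blast intro: word_cong.sym word_cong.trans)+

lemma word_class_eq_iff:
  assumes "xs \<in> lists A"
  shows "word_class A R xs = word_class A R ys \<longleftrightarrow> word_cong A R xs ys"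
proof
  assume "word_class A R xs = word_class A R ys"
  moreover have "xs \<in> word_class A R xs"
    using assms by (auto simp: word_class_def intro: word_cong.refl)
  ultimately show "word_cong A R xs ys"
    by (auto simp: word_class_def intro: word_cong.sym)
next
  assume "word_cong A R xs ys"
  then show "word_class A R xs = word_class A R ys"
    unfolding word_class_def by (blast intro: word_cong.sym word_cong.trans)
qed

lemma word_class_mult:
  assumes "xs \<in> lists A" "ys \<in> lists A"
  shows "word_class A R xs \<otimes>\<^bsub>presented_monoid A R\<^esub> word_class A R ys = word_class A R (xs @ ys)"
proof -
  have "word_class A R (x @ y) = word_class A R (xs @ ys)"
    if "x \<in> word_class A R xs" "y \<in> word_class A R ys" for x y
  proof -
    have c: "word_cong A R xs x" "word_cong A R ys y"
      using that by (auto simp: word_class_def)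
    then have "x \<in> lists A" "y \<in> lists A"
      by (auto dest: word_cong_in_lists)
    then have "word_cong A R (xs @ ys) (x @ y)"
      by (blast intro: word_cong.trans word_cong_append_right[OF c(1) assms(2)]
          word_cong_append_left[OF c(2)])
    then show ?thesis
      using assms word_class_eq_iff[of "xs @ ys" A R "x @ y"] by simp
  qed
  moreover have "xs \<in> word_class A R xs" "ys \<in> word_class A R ys"
    using assms by (auto simp: word_class_def intro: word_cong.refl)
  ultimately have "(\<Union>x\<in>word_class A R xs. \<Union>y\<in>word_class A R ys. word_class A R (x @ y))
      = word_class A R (xs @ ys)"
    by (metis (no_types, lifting) SUP_eq_const empty_iff)
  then show ?thesis by (simp add: presented_monoid_def)
qed

lemma monoid_presented_monoid: "monoid (presented_monoid A R)"
proof (rule monoidI)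
  let ?G = "presented_monoid A R"
  have carr: "carrier ?G = word_class A R ` lists A" and one: "\<one>\<^bsub>?G\<^esub> = word_class A R []"
    by (simp_all add: presented_monoid_def)
  show "\<one>\<^bsub>?G\<^esub> \<in> carrier ?G" unfolding carr one by blast
  fix x assume "x \<in> carrier ?G"
  then obtain xs where x: "xs \<in> lists A" "x = word_class A R xs" unfolding carr by blast
  show "\<one>\<^bsub>?G\<^esub> \<otimes>\<^bsub>?G\<^esub> x = x" "x \<otimes>\<^bsub>?G\<^esub> \<one>\<^bsub>?G\<^esub> = x"
    using x word_class_mult[of "[]" A xs R] word_class_mult[of xs A "[]" R] by (simp_all add: one)
  fix y assume "y \<in> carrier ?G"
  then obtain ys where y: "ys \<in> lists A" "y = word_class A R ys" unfolding carr by blast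
  show "x \<otimes>\<^bsub>?G\<^esub> y \<in> carrier ?G"
    using x y by (auto simp: word_class_mult carr)
  fix z assume "z \<in> carrier ?G"
  then obtain zs where z: "zs \<in> lists A" "z = word_class A R zs" unfolding carr by blast
  show "x \<otimes>\<^bsub>?G\<^esub> y \<otimes>\<^bsub>?G\<^esub> z = x \<otimes>\<^bsub>?G\<^esub> (y \<otimes>\<^bsub>?G\<^esub> z)"
    using x y z by (auto simp: word_class_mult simp del: in_lists_conv_set)
qed


section \<open>Coxeter groups\<close>

definition coxeter_matrix :: "'i set \<Rightarrow> ('i \<Rightarrow> 'i \<Rightarrow> enat) \<Rightarrow> bool" where
  "coxeter_matrix I M \<longleftrightarrow> finite I \<and>
    (\<forall>i\<in>I. M i i = 1) \<and>
    (\<forall>i\<in>I. \<forall>j\<in>I. M i j = M j i \<and> (i \<noteq> j \<longrightarrow> 2 \<le> M i j))"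

text \<open>
  The relations \<open>(s\<^sub>i s\<^sub>j)^m = 1\<close> for all \<open>i, j\<close> with finite \<open>m = m\<^sub>i\<^sub>j\<close>. For \<open>i = j\<close> this is
  \<open>s\<^sub>i s\<^sub>i = 1\<close>, so the generators are involutions and the monoid with this presentation is
  the group with this presentation.
\<close>

definition coxeter_relations :: "'i set \<Rightarrow> ('i \<Rightarrow> 'i \<Rightarrow> enat) \<Rightarrow> ('i list \<times> 'i list) set" where
  "coxeter_relations I M =
    {(concat (replicate m [i, j]), []) | i j m. i \<in> I \<and> j \<in> I \<and> M i j = enat m}"

definition coxeter_group :: "'i set \<Rightarrow> ('i \<Rightarrow> 'i \<Rightarrow> enat) \<Rightarrow> 'i list set monoid" where
  "coxeter_group I M = presented_monoid I (coxeter_relations I M)"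

definition simple_gen :: "'i set \<Rightarrow> ('i \<Rightarrow> 'i \<Rightarrow> enat) \<Rightarrow> 'i \<Rightarrow> 'i list set" where
  "simple_gen I M i = word_class I (coxeter_relations I M) [i]"

lemma group_coxeter_group:
  assumes "coxeter_matrix I M"
  shows "group (coxeter_group I M)"
proof -
  let ?R = "coxeter_relations I M"
  have sq: "word_cong I ?R [i, i] []" if "i \<in> I" for i
  proof -
    have "M i i = enat 1"
      using assms that by (simp add: coxeter_matrix_def one_enat_def)
    then have "(concat (replicate 1 [i, i]), []) \<in> ?R"
      using that unfolding coxeter_relations_def by blast
    then show ?thesis
      using word_cong.rel[of "[i, i]" "[]" ?R I "[]" "[]"] that by simp
  qed
  have cancel: "xs \<in> lists I \<Longrightarrow> word_cong I ?R (rev xs @ xs) []" for xs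
  proof (induction xs)
    case Nil
    then show ?case by (simp add: word_cong.refl)
  next
    case (Cons i xs)
    then have i: "i \<in> I" and xs: "xs \<in> lists I" by auto
    have "word_cong I ?R (rev xs @ [i, i] @ xs) (rev xs @ [] @ xs)"
      by (rule word_cong_append_left[OF word_cong_append_right[OF sq[OF i] xs]]) (use xs in auto)
    then show ?case
      using word_cong.trans[of I ?R _ _ "[]"] Cons.IH[OF xs] by simp
  qed
  show ?thesis
    unfolding coxeter_group_def
  proof (rule monoid.group_l_invI[OF monoid_presented_monoid])
    fix x assume "x \<in> carrier (presented_monoid I ?R)"
    then obtain xs where xs: "xs \<in> lists I" "x = word_class I ?R xs"
      by (auto simp: presented_monoid_def)
    then have rxs: "rev xs \<in> lists I" by auto
    have "word_class I ?R (rev xs @ xs) = word_class I ?R []"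
      using cancel[of xs] xs(1) rxs by (subst word_class_eq_iff) (auto simp del: in_lists_conv_set)
    then have "word_class I ?R (rev xs) \<otimes>\<^bsub>presented_monoid I ?R\<^esub> x = \<one>\<^bsub>presented_monoid I ?R\<^esub>"
      using word_class_mult[OF rxs xs(1)] xs(2) by (simp add: presented_monoid_def)
    moreover have "word_class I ?R (rev xs) \<in> carrier (presented_monoid I ?R)"
      using rxs by (simp add: presented_monoid_def)
    ultimately show "\<exists>y\<in>carrier (presented_monoid I ?R). y \<otimes>\<^bsub>presented_monoid I ?R\<^esub> x = \<one>\<^bsub>presented_monoid I ?R\<^esub>"
      by blast
  qed
qed

definition finite_type :: "'i set \<Rightarrow> ('i \<Rightarrow> 'i \<Rightarrow> enat) \<Rightarrow> bool" where
  "finite_type I M \<longleftrightarrow> finite (carrier (coxeter_group I M))"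

text \<open>Since \<open>w\<close> is the set of words representing it, \<open>I\<close> and \<open>M\<close> need not be given.\<close>

definition cox_length :: "'i list set \<Rightarrow> nat" where
  "cox_length w = (LEAST n. \<exists>xs\<in>w. length xs = n)"

definition parabolic_subgroup :: "'i set \<Rightarrow> ('i \<Rightarrow> 'i \<Rightarrow> enat) \<Rightarrow> 'i set \<Rightarrow> 'i list set set" where
  "parabolic_subgroup I M J = generate (coxeter_group I M) (simple_gen I M ` J)"

definition longest_elt :: "'i set \<Rightarrow> ('i \<Rightarrow> 'i \<Rightarrow> enat) \<Rightarrow> 'i set \<Rightarrow> 'i list set" where
  "longest_elt I M J = (THE w. w \<in> parabolic_subgroup I M J \<and>
     (\<forall>v\<in>parabolic_subgroup I M J. cox_length v \<le> cox_length w))"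

text \<open>The element \<open>w\<^bsub>J;K\<^esub>\<close>, for \<open>J \<subseteq> K \<subseteq> I\<close>.\<close>

definition par_elt :: "'i set \<Rightarrow> ('i \<Rightarrow> 'i \<Rightarrow> enat) \<Rightarrow> 'i set \<Rightarrow> 'i set \<Rightarrow> 'i list set" where
  "par_elt I M J K = longest_elt I M J \<otimes>\<^bsub>coxeter_group I M\<^esub> longest_elt I M K"


section \<open>The Hecke monoid\<close>

fun alternating_word :: "'i \<Rightarrow> 'i \<Rightarrow> nat \<Rightarrow> 'i list" where
  "alternating_word i j 0 = []"
| "alternating_word i j (Suc n) = i # alternating_word j i n"

definition hecke_relations :: "'i set \<Rightarrow> ('i \<Rightarrow> 'i \<Rightarrow> enat) \<Rightarrow> ('i list \<times> 'i list) set" where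
  "hecke_relations I M =
    {([i, i], [i]) | i. i \<in> I} \<union>
    {(alternating_word i j m, alternating_word j i m) | i j m.
       i \<in> I \<and> j \<in> I \<and> i \<noteq> j \<and> M i j = enat m}"

text \<open>
  The identification of \<open>W(M)\<close> with the monoid presented by the Hecke relations sends \<open>w\<close> to
  the class of a reduced word of \<open>w\<close>. By Matsumoto's theorem the class does not depend on the
  choice of the reduced word.
\<close>

definition hecke_class :: "'i set \<Rightarrow> ('i \<Rightarrow> 'i \<Rightarrow> enat) \<Rightarrow> 'i list set \<Rightarrow> 'i list set" where
  "hecke_class I M w =
     word_class I (hecke_relations I M) (SOME xs. xs \<in> w \<and> length xs = cox_length w)"

text \<open>The Hecke monoid on the underlying set of \<open>W(M)\<close>, with the product transported along this
  identification.\<close>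

definition hecke_monoid :: "'i set \<Rightarrow> ('i \<Rightarrow> 'i \<Rightarrow> enat) \<Rightarrow> 'i list set monoid" where
  "hecke_monoid I M =
    \<lparr>carrier = carrier (coxeter_group I M),
     mult = (\<lambda>u v. inv_into (carrier (coxeter_group I M)) (hecke_class I M)
       (hecke_class I M u \<otimes>\<^bsub>presented_monoid I (hecke_relations I M)\<^esub> hecke_class I M v)),
     one = \<one>\<^bsub>coxeter_group I M\<^esub>\<rparr>"

definition hecke_submonoid :: "'i set \<Rightarrow> ('i \<Rightarrow> 'i \<Rightarrow> enat) \<Rightarrow> 'i set \<Rightarrow> 'i list set monoid" where
  "hecke_submonoid I M J = (hecke_monoid I M)\<lparr>carrier := parabolic_subgroup I M J\<rparr>"

text \<open>The set \<open>J \<star>\<^sub>I K\<close>.\<close>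

definition star_set :: "'i set \<Rightarrow> ('i \<Rightarrow> 'i \<Rightarrow> enat) \<Rightarrow> 'i set \<Rightarrow> 'i set \<Rightarrow> 'i set" where
  "star_set I M J K = (THE L. L \<subseteq> J \<inter> K \<and>
     par_elt I M J I \<otimes>\<^bsub>hecke_monoid I M\<^esub> par_elt I M K I = par_elt I M L I)"


section \<open>Parabolic projections\<close>

text \<open>The library's \<^const>\<open>hom\<close> does not require the unit to be preserved.\<close>

definition unital_hom :: "('a, 'c) monoid_scheme \<Rightarrow> ('b, 'd) monoid_scheme \<Rightarrow> ('a \<Rightarrow> 'b) set" where
  "unital_hom G H = {f \<in> hom G H. f \<one>\<^bsub>G\<^esub> = \<one>\<^bsub>H\<^esub>}"

text \<open>Extensionality fixes the values outside \<open>W(M)\<close>, so that the homomorphism is unique as a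
  HOL function.\<close>

definition parabolic_projection ::
  "'i set \<Rightarrow> ('i \<Rightarrow> 'i \<Rightarrow> enat) \<Rightarrow> 'i set \<Rightarrow> 'i list set \<Rightarrow> 'i list set" where
  "parabolic_projection I M J = (THE p.
     p \<in> extensional (carrier (hecke_monoid I M)) \<and>
     p \<in> unital_hom (hecke_monoid I M) (hecke_submonoid I M J) \<and>
     (\<forall>i\<in>J. p (simple_gen I M i) = simple_gen I M i) \<and>
     (\<forall>i\<in>I - J. p (simple_gen I M i) = \<one>\<^bsub>hecke_monoid I M\<^esub>))"

definition parabolic_hom ::
  "'i set \<Rightarrow> ('i \<Rightarrow> 'i \<Rightarrow> enat) \<Rightarrow> 'i set \<Rightarrow> ('i list set \<Rightarrow> 'i list set) \<Rightarrow> bool" where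
  "parabolic_hom I M J \<phi> \<longleftrightarrow>
     \<phi> \<in> unital_hom (hecke_monoid I M) (hecke_submonoid I M J) \<and>
     \<phi> ` {par_elt I M K I | K. K \<subseteq> I} \<subseteq> {par_elt I M L J | L. L \<subseteq> J}"

end

theory Submission
  imports Defs Complex_Main
begin

text \<open>
  Put \<open>x\<^sub>K = w\<^bsub>K;I\<^esub>\<close>. For each simple \<open>s\<close>, the product \<open>x\<^sub>K \<star> s\<close> is \<open>x\<^sub>K\<close> or \<open>s' \<star> x\<^sub>K\<close> with \<open>s' \<in> K\<close>,
  because conjugation by a longest element permutes the simple generators. Applying \<open>p\<^sub>J\<close>, the element
  \<open>v = p\<^sub>J(x\<^sub>K)\<close> has the same property with respect to \<open>J\<close> and \<open>J \<inter> K\<close>, which forces \<open>v = w\<^bsub>L;J\<^esub>\<close>, where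
  \<open>L \<subseteq> J \<inter> K\<close> is the set of left ascents of \<open>v\<close> in \<open>J\<close>. Generators outside \<open>J\<close> are absorbed by
  \<open>W\<^sub>J x\<^sub>J\<close> on the left, so \<open>y \<star> x\<^sub>J = p\<^sub>J(y) x\<^sub>J\<close>; hence \<open>x\<^sub>K \<star> x\<^sub>J = w\<^bsub>L;J\<^esub> x\<^sub>J = x\<^sub>L\<close>. The
  anti-automorphism \<open>y \<mapsto> w\<^sub>\<circ> y\<^sup>-\<^sup>1 w\<^sub>\<circ>\<close> fixes all \<open>x\<^sub>J\<close>, so \<open>x\<^sub>J \<star> x\<^sub>K = x\<^sub>L\<close> as well and \<open>L = J \<star>\<^sub>I K\<close>.

  That the Hecke monoid lives on \<open>W\<close> needs Matsumoto's theorem, which rests on the exchange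
  condition (from the parity of occurrences of a reflection in a word) and on \<open>s\<^sub>i s\<^sub>j\<close> having
  order exactly \<open>m\<^sub>i\<^sub>j\<close> (from the geometric representation).
\<close>

section \<open>Words\<close>

declare in_lists_conv_set [simp del] in_listsI [rule del] in_listsD [rule del]

lemma rev_in_lists_iff [simp]: "rev xs \<in> lists A \<longleftrightarrow> xs \<in> lists A"
  by (simp add: in_lists_conv_set)

lemma take_in_lists [simp]: "xs \<in> lists A \<Longrightarrow> take k xs \<in> lists A"
  by (auto simp: in_lists_conv_set dest: in_set_takeD)

lemma drop_in_lists [simp]: "xs \<in> lists A \<Longrightarrow> drop k xs \<in> lists A"
  by (auto simp: in_lists_conv_set dest: in_set_dropD)

lemma nth_in_of_lists: "xs \<in> lists A \<Longrightarrow> k < length xs \<Longrightarrow> xs ! k \<in> A"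
  by (auto simp: in_lists_conv_set)

lemma length_alternating_word [simp]: "length (alternating_word i j n) = n"
  by (induction n arbitrary: i j) auto

lemma alternating_word_in_lists [simp]: "i \<in> A \<Longrightarrow> j \<in> A \<Longrightarrow> alternating_word i j n \<in> lists A"
  by (induction n arbitrary: i j) auto

lemma alternating_word_snoc:
  "alternating_word i j (Suc n) = alternating_word i j n @ [if even n then i else j]"
  by (induction n arbitrary: i j) auto

lemma alternating_word_add_even:
  "alternating_word i j (2 * m + n) = alternating_word i j (2 * m) @ alternating_word i j n"
  by (induction m arbitrary: i j) auto

lemma concat_replicate_pair: "concat (replicate m [i, j]) = alternating_word i j (2 * m)"
  by (induction m) auto

text \<open>The reflections s_1 ... s_k ... s_1 read off an alternating word are again alternating
  words, of odd length. This makes the reflections of a relator explicit.\<close>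

lemma alternating_word_palindrome:
  "alternating_word i j n @ [if even n then i else j] @ rev (alternating_word i j n)
    = alternating_word i j (2 * n + 1)"
proof (induction n arbitrary: i j)
  case (Suc n)
  have "alternating_word i j (2 * Suc n + 1) = i # alternating_word j i (2 * n + 1) @ [i]"
    using alternating_word_snoc[of i j "2 * n + 2"] by simp
  then show ?case using Suc[of j i, symmetric] by (simp split: if_splits)
qed simp

text \<open>Links the two forms of the relation: one side of a braid relation times the inverse of
  the other is the relator of length \<open>2 * n\<close>.\<close>

lemma alternating_word_append_rev:
  "alternating_word i j n @ rev (alternating_word j i n) = alternating_word i j (2 * n)"
proof (induction n arbitrary: i j)
  case (Suc n)
  have "alternating_word i j (2 * Suc n) = i # alternating_word j i (2 * n) @ [j]"
    using alternating_word_snoc[of i j "2 * n + 1"] by simp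
  then show ?case using Suc[of j i, symmetric] by simp
qed simp

lemma take_alternating_word: "k \<le> n \<Longrightarrow> take k (alternating_word i j n) = alternating_word i j k"
proof (induction n arbitrary: i j k)
  case (Suc n)
  then show ?case by (cases k) auto
qed simp

lemma nth_alternating_word: "k < n \<Longrightarrow> alternating_word i j n ! k = (if even k then i else j)"
proof (induction n arbitrary: i j k)
  case (Suc n)
  then show ?case by (cases k) auto
qed simp

lemma set_alternating_word: "2 \<le> m \<Longrightarrow> set (alternating_word i j m) = {i, j}"
proof (induction m arbitrary: i j)
  case (Suc m)
  then show ?case by (cases "m = 1") auto
qed simp

lemma word_cong_Cons: "i \<in> A \<Longrightarrow> word_cong A R xs ys \<Longrightarrow> word_cong A R (i # xs) (i # ys)"
  using word_cong_append_left[of A R xs ys "[i]"] by simp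

lemma append_take_drop_delete:
  assumes "length xs \<le> k"
  shows "take k (xs @ ys) @ drop (Suc k) (xs @ ys)
    = xs @ take (k - length xs) ys @ drop (Suc (k - length xs)) ys"
  using assms by (simp add: Suc_diff_le)

section \<open>The exchange condition\<close>

locale coxeter_system =
  fixes I :: "'i set" and M :: "'i \<Rightarrow> 'i \<Rightarrow> enat"
  assumes coxeter_matrix: "coxeter_matrix I M"
begin

abbreviation G where "G \<equiv> coxeter_group I M"
abbreviation el where "el \<equiv> word_class I (coxeter_relations I M)"
abbreviation s where "s \<equiv> simple_gen I M"
abbreviation len :: "'i list set \<Rightarrow> nat" where "len \<equiv> cox_length"
abbreviation mul (infixl "\<cdot>" 70) where "x \<cdot> y \<equiv> x \<otimes>\<^bsub>G\<^esub> y"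

sublocale G: group G by (rule group_coxeter_group[OF coxeter_matrix])

section \<open>Group elements represented by words\<close>

lemma s_eq: "s i = el [i]" by (simp add: simple_gen_def)
lemma one_eq: "\<one>\<^bsub>G\<^esub> = el []" by (simp add: coxeter_group_def presented_monoid_def)
lemma carrier_eq: "carrier G = el ` lists I" by (simp add: coxeter_group_def presented_monoid_def)
lemma el_closed [simp, intro]: "xs \<in> lists I \<Longrightarrow> el xs \<in> carrier G"
  unfolding carrier_eq by (rule imageI)
lemma s_closed [simp, intro]: "i \<in> I \<Longrightarrow> s i \<in> carrier G" by (simp add: s_eq)
lemma el_append: "xs \<in> lists I \<Longrightarrow> ys \<in> lists I \<Longrightarrow> el (xs @ ys) = el xs \<cdot> el ys"
  by (simp only: coxeter_group_def word_class_mult)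
lemma el_Cons: "i \<in> I \<Longrightarrow> xs \<in> lists I \<Longrightarrow> el (i # xs) = s i \<cdot> el xs"
  using el_append[of "[i]" xs] by (simp add: s_eq)
lemma el_Nil [simp]: "el [] = \<one>\<^bsub>G\<^esub>" by (simp add: one_eq)

lemma el_relation:
  assumes "i \<in> I" "j \<in> I" "M i j = enat m"
  shows "el (alternating_word i j (2 * m)) = \<one>\<^bsub>G\<^esub>"
proof -
  have "(alternating_word i j (2 * m), []) \<in> coxeter_relations I M"
    using assms unfolding coxeter_relations_def by (auto simp flip: concat_replicate_pair)
  then have "word_cong I (coxeter_relations I M) ([] @ alternating_word i j (2 * m) @ []) ([] @ [] @ [])"
    by (rule word_cong.rel) (use assms in auto)
  then show ?thesis
    using word_class_eq_iff[of "alternating_word i j (2 * m)" I "coxeter_relations I M" "[]"]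
      alternating_word_in_lists[of i I j] assms by simp
qed

lemma M_refl: "i \<in> I \<Longrightarrow> M i i = enat 1"
  using coxeter_matrix by (simp add: coxeter_matrix_def one_enat_def)
lemma M_sym: "i \<in> I \<Longrightarrow> j \<in> I \<Longrightarrow> M i j = M j i"
  using coxeter_matrix by (auto simp add: coxeter_matrix_def)
lemma M_ge_2: "i \<in> I \<Longrightarrow> j \<in> I \<Longrightarrow> i \<noteq> j \<Longrightarrow> 2 \<le> M i j"
  using coxeter_matrix by (auto simp add: coxeter_matrix_def)
lemma M_enat_ge_2: "i \<in> I \<Longrightarrow> j \<in> I \<Longrightarrow> i \<noteq> j \<Longrightarrow> M i j = enat m \<Longrightarrow> 2 \<le> m"
  using M_ge_2[of i j] by (simp add: numeral_eq_enat)

lemma s_s: "i \<in> I \<Longrightarrow> s i \<cdot> s i = \<one>\<^bsub>G\<^esub>"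
  using el_relation[OF _ _ M_refl, of i] by (simp add: el_Cons numeral_2_eq_2)

lemma inv_s [simp]: "i \<in> I \<Longrightarrow> inv\<^bsub>G\<^esub> s i = s i"
  using s_s G.inv_equality by auto

lemma s_s_mul [simp]: "i \<in> I \<Longrightarrow> w \<in> carrier G \<Longrightarrow> s i \<cdot> (s i \<cdot> w) = w"
  by (simp add: s_s flip: G.m_assoc)

lemma inv_el: "xs \<in> lists I \<Longrightarrow> inv\<^bsub>G\<^esub> el xs = el (rev xs)"
proof (induction xs)
  case (Cons i xs)
  then show ?case
    by (simp add: el_Cons G.inv_mult_group el_append)
qed simp

text \<open>The indicator function of the left inversion set, read off a word: \<open>inversion xs t\<close> holds
  iff the reflection \<open>t\<close> occurs an odd number of times among the
  \<open>s\<^sub>1 \<cdots> s\<^sub>k \<cdots> s\<^sub>1\<close>. Parity is what makes it an invariant of the group element.\<close>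

fun inversion :: "'i list \<Rightarrow> 'i list set \<Rightarrow> bool" where
  "inversion [] t = False"
| "inversion (i # xs) t = ((t = s i) \<noteq> inversion xs (s i \<cdot> t \<cdot> s i))"

text \<open>Cocycle identity: the reflections of a concatenation are those of the first word
  together with the conjugates of those of the second. Inequality of truth values is addition of
  parities.\<close>

lemma inversion_append:
  assumes "xs \<in> lists I" "ys \<in> lists I" "t \<in> carrier G"
  shows "inversion (xs @ ys) t = (inversion xs t \<noteq> inversion ys (inv\<^bsub>G\<^esub> el xs \<cdot> t \<cdot> el xs))"
  using assms
proof (induction xs arbitrary: t)
  case (Cons i xs)
  then show ?case
    by (simp add: el_Cons G.inv_mult_group G.m_assoc) blast
qed simp

lemma inversion_snoc:
  assumes "xs \<in> lists I" "i \<in> I" "t \<in> carrier G"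
  shows "inversion (xs @ [i]) t = (inversion xs t \<noteq> (t = el (xs @ [i] @ rev xs)))"
proof -
  have "(inv\<^bsub>G\<^esub> el xs \<cdot> t \<cdot> el xs = s i) = (t = el xs \<cdot> s i \<cdot> inv\<^bsub>G\<^esub> el xs)"
  proof
    assume "inv\<^bsub>G\<^esub> el xs \<cdot> t \<cdot> el xs = s i"
    from this[symmetric] show "t = el xs \<cdot> s i \<cdot> inv\<^bsub>G\<^esub> el xs"
      using assms by (simp add: G.m_assoc) (simp add: G.inv_solve_left flip: G.m_assoc)
  next
    assume "t = el xs \<cdot> s i \<cdot> inv\<^bsub>G\<^esub> el xs"
    then show "inv\<^bsub>G\<^esub> el xs \<cdot> t \<cdot> el xs = s i"
      using assms by (simp add: G.m_assoc) (simp flip: G.m_assoc)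
  qed
  also have "el xs \<cdot> s i \<cdot> inv\<^bsub>G\<^esub> el xs = el (xs @ [i] @ rev xs)"
    using assms by (simp add: inv_el el_append el_Cons G.m_assoc)
  finally show ?thesis using assms inversion_append[of xs "[i]" t] by simp
qed

lemma inversion_alternating:
  assumes "i \<in> I" "j \<in> I" "t \<in> carrier G"
  shows "inversion (alternating_word i j n) t
    = odd (card {k. k < n \<and> t = el (alternating_word i j (2 * k + 1))})"
proof (induction n)
  case (Suc n)
  have *: "{k. k < Suc n \<and> t = el (alternating_word i j (2 * k + 1))} =
    (if t = el (alternating_word i j (2 * n + 1)) then insert n else id)
     {k. k < n \<and> t = el (alternating_word i j (2 * k + 1))}"
    by (auto simp: less_Suc_eq simp del: alternating_word.simps)
  show ?case
    unfolding alternating_word_snoc * using assms Suc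
    by (subst inversion_snoc)
       (auto simp only: alternating_word_in_lists alternating_word_palindrome if_True if_False
         split: if_splits, auto)
qed simp

text \<open>The relator represents the identity, so its \<open>2 * m\<close> reflections repeat with
  period \<open>m\<close> and each of them occurs an even number of times.\<close>

lemma inversion_relation:
  assumes "i \<in> I" "j \<in> I" "M i j = enat m" "t \<in> carrier G"
  shows "\<not> inversion (alternating_word i j (2 * m)) t"
proof -
  define P where "P k \<longleftrightarrow> t = el (alternating_word i j (2 * k + 1))" for k
  have per: "P (m + k) = P k" for k
    using assms el_relation[OF assms(1-3)] alternating_word_add_even[of i j m "2 * k + 1"]
    by (simp add: P_def algebra_simps el_append alternating_word_in_lists
        del: alternating_word.simps)
  have "{k. k < 2 * m \<and> P k} = {k. k < m \<and> P k} \<union> (+) m ` {k. k < m \<and> P k}"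
  proof (intro equalityI subsetI)
    fix k assume "k \<in> {k. k < 2 * m \<and> P k}"
    then show "k \<in> {k. k < m \<and> P k} \<union> (+) m ` {k. k < m \<and> P k}"
      using per[of "k - m"] by (cases "k < m") (auto intro!: image_eqI[of _ _ "k - m"])
  qed (use per in auto)
  moreover have "{k. k < m \<and> P k} \<inter> (+) m ` {k. k < m \<and> P k} = {}" by auto
  ultimately have "card {k. k < 2 * m \<and> P k} = 2 * card {k. k < m \<and> P k}"
    by (simp add: card_Un_disjoint card_image)
  then show ?thesis using inversion_alternating[OF assms(1,2,4)] P_def by simp
qed

text \<open>A relator is trivial in the group and has no inversions, so by the cocycle identity it
  can be deleted from any word.\<close>

lemma inversion_cong:
  assumes "word_cong I (coxeter_relations I M) xs ys" "t \<in> carrier G"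
  shows "inversion xs t = inversion ys t"
  using assms
proof (induction arbitrary: t rule: word_cong.induct)
  case (rel u v xs ys)
  obtain i j m where uv: "u = alternating_word i j (2 * m)" "v = []" "i \<in> I" "j \<in> I" "M i j = enat m"
    using rel unfolding coxeter_relations_def by (auto simp: concat_replicate_pair)
  show ?case
    using rel(2-) uv inversion_relation[of i j m] el_relation[of i j m]
    by (simp add: inversion_append el_append alternating_word_in_lists)
qed auto

section \<open>Length and reduced words\<close>

lemma el_eq_iff: "xs \<in> lists I \<Longrightarrow> el xs = el ys \<longleftrightarrow> word_cong I (coxeter_relations I M) xs ys"
  by (rule word_class_eq_iff)

lemma el_obtain_word:
  assumes "w \<in> carrier G"
  obtains xs where "xs \<in> lists I" "el xs = w" "length xs = len w"
proof -
  obtain ys where ys: "ys \<in> lists I" "w = el ys" using assms unfolding carrier_eq by blast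
  have "ys \<in> w" using ys by (auto simp: word_class_def intro: word_cong.refl)
  then have "\<exists>n. \<exists>xs\<in>w. length xs = n" by blast
  then have "\<exists>xs\<in>w. length xs = len w" unfolding cox_length_def by (rule LeastI_ex)
  then obtain xs where "xs \<in> w" "length xs = len w" by blast
  moreover from this(1) have "word_cong I (coxeter_relations I M) ys xs"
    unfolding ys(2) word_class_def by simp
  ultimately show ?thesis
    using that[of xs] ys word_cong_in_lists[of I "coxeter_relations I M" ys xs] word_class_eq_iff[of ys I "coxeter_relations I M" xs]
    by auto
qed

lemma len_el_le: "xs \<in> lists I \<Longrightarrow> len (el xs) \<le> length xs"
  unfolding cox_length_def
  by (rule Least_le) (auto simp: word_class_def intro!: bexI[of _ xs] word_cong.refl)

definition reduced :: "'i list \<Rightarrow> bool" where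
  "reduced xs \<longleftrightarrow> xs \<in> lists I \<and> length xs = len (el xs)"

lemma obtain_reduced:
  assumes "w \<in> carrier G" obtains xs where "reduced xs" "el xs = w"
  using el_obtain_word[OF assms] unfolding reduced_def by metis

lemma reduced_in_lists [dest]: "reduced xs \<Longrightarrow> xs \<in> lists I" by (simp add: reduced_def)

lemma len_one [simp]: "len \<one>\<^bsub>G\<^esub> = 0" using len_el_le[of "[]"] by simp

lemma len_eq_0: "w \<in> carrier G \<Longrightarrow> len w = 0 \<Longrightarrow> w = \<one>\<^bsub>G\<^esub>"
  using el_obtain_word[of w] by (metis el_Nil length_0_conv)

lemma len_mul_le: "u \<in> carrier G \<Longrightarrow> v \<in> carrier G \<Longrightarrow> len (u \<cdot> v) \<le> len u + len v"
  by (metis append_in_lists_conv el_append el_obtain_word len_el_le length_append)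

lemma len_inv_le: "w \<in> carrier G \<Longrightarrow> len (inv\<^bsub>G\<^esub> w) \<le> len w"
  by (metis el_obtain_word inv_el len_el_le length_rev rev_in_lists_iff)

lemma len_inv [simp]: "w \<in> carrier G \<Longrightarrow> len (inv\<^bsub>G\<^esub> w) = len w"
  using len_inv_le[of w] len_inv_le[of "inv\<^bsub>G\<^esub> w"] by simp

lemma len_s_le: "i \<in> I \<Longrightarrow> len (s i) \<le> 1"
  using len_el_le[of "[i]"] by (simp add: s_eq)

lemma len_s_mul_le: "i \<in> I \<Longrightarrow> w \<in> carrier G \<Longrightarrow> len (s i \<cdot> w) \<le> Suc (len w)"
  using len_mul_le[of "s i" w] len_s_le[of i] by simp

lemma len_le_s_mul: "i \<in> I \<Longrightarrow> w \<in> carrier G \<Longrightarrow> len w \<le> Suc (len (s i \<cdot> w))"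
  using len_s_mul_le[of i "s i \<cdot> w"] by simp

section \<open>Exchange and left descents\<close>

text \<open>A reflection with odd count occurs at some position \<open>k\<close>, and multiplying by
  it cancels the letter there. In the induction \<open>t\<close> is either the reflection of the
  first letter or conjugate to one of the tail. The second conjunct, locating \<open>t\<close>,
  later excludes certain positions.\<close>

lemma inversion_exchange:
  assumes "inversion xs t" "xs \<in> lists I" "t \<in> carrier G"
  shows "\<exists>k<length xs. t \<cdot> el xs = el (take k xs @ drop (Suc k) xs) \<and>
    t = el (take k xs @ [xs ! k] @ rev (take k xs))"
  using assms
proof (induction xs arbitrary: t)
  case (Cons i xs)
  then have i: "i \<in> I" and xs: "xs \<in> lists I" and t: "t \<in> carrier G" by auto
  consider "t = s i" | "inversion xs (s i \<cdot> t \<cdot> s i)" using Cons.prems(1) by auto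
  then show ?case
  proof cases
    case 1
    then show ?thesis using i xs by (intro exI[of _ 0]) (simp add: el_Cons s_s)
  next
    case 2
    then obtain k where k: "k < length xs"
      "s i \<cdot> t \<cdot> s i \<cdot> el xs = el (take k xs @ drop (Suc k) xs)"
      "s i \<cdot> t \<cdot> s i = el (take k xs @ [xs ! k] @ rev (take k xs))"
      using Cons.IH[OF 2 xs] i t by (metis G.m_closed s_closed)
    have l: "take k xs \<in> lists I" "drop (Suc k) xs \<in> lists I" "xs ! k \<in> I"
      using xs k(1) by (simp_all add: nth_in_of_lists)
    have "t \<cdot> (s i \<cdot> el xs) = s i \<cdot> (s i \<cdot> t \<cdot> s i \<cdot> el xs)"
      using i xs t by (simp add: G.m_assoc)
    then have 1: "t \<cdot> el (i # xs) = el (take (Suc k) (i # xs) @ drop (Suc (Suc k)) (i # xs))"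
      using k(2) l i xs by (simp add: el_Cons)
    have "t = s i \<cdot> (s i \<cdot> t \<cdot> s i) \<cdot> s i" using i t by (simp add: G.m_assoc s_s)
    also have "\<dots> = el ([i] @ (take k xs @ [xs ! k] @ rev (take k xs)) @ [i])"
      unfolding k(3) using i l
      by (simp add: el_append el_Cons G.m_assoc s_s)
    finally show ?thesis using 1 k(1) by (intro exI[of _ "Suc k"]) simp
  qed
qed simp

lemma len_s_mul_less_if_inversion:
  assumes "inversion xs (s i)" "reduced xs" "i \<in> I"
  shows "len (s i \<cdot> el xs) < len (el xs)"
proof -
  have xs: "xs \<in> lists I" using assms by auto
  obtain k where "k < length xs" "s i \<cdot> el xs = el (take k xs @ drop (Suc k) xs)"
    using inversion_exchange[OF assms(1) xs] assms(3) by auto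
  moreover have "take k xs @ drop (Suc k) xs \<in> lists I"
    using xs by simp
  ultimately show ?thesis
    using len_el_le[of "take k xs @ drop (Suc k) xs"] assms(2) unfolding reduced_def by simp
qed

text \<open>For the converse, prepending \<open>i\<close> flips the parity at \<open>s i\<close>. If
  \<open>s i\<close> is not an inversion of the word, it is one of the product with
  \<open>s i\<close>, and the direction already proved makes that product the longer
  element.\<close>

lemma inversion_iff_descent:
  assumes "xs \<in> lists I" "i \<in> I"
  shows "inversion xs (s i) \<longleftrightarrow> len (s i \<cdot> el xs) < len (el xs)"
proof -
  obtain ys where ys: "reduced ys" "el ys = el xs" using obtain_reduced[of "el xs"] assms by auto
  have ysI: "ys \<in> lists I" using ys by auto
  have eq: "inversion xs (s i) = inversion ys (s i)"
    using inversion_cong[of xs ys "s i"] el_eq_iff[of xs ys] assms ys(2) by simp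
  show ?thesis
  proof (cases "inversion ys (s i)")
    case True
    then show ?thesis using len_s_mul_less_if_inversion[OF True ys(1) assms(2)] eq ys by simp
  next
    case False
    obtain zs where zs: "reduced zs" "el zs = s i \<cdot> el ys"
      using obtain_reduced[of "s i \<cdot> el ys"] assms ysI by auto
    have "inversion (i # ys) (s i)" using False assms by (simp add: s_s)
    then have "inversion zs (s i)"
      using inversion_cong[of "i # ys" zs "s i"] el_eq_iff[of "i # ys" zs] assms ysI zs(2)
      by (simp add: el_Cons)
    then have "len (s i \<cdot> el zs) < len (el zs)" using len_s_mul_less_if_inversion[OF _ zs(1) assms(2)] by simp
    then show ?thesis using False eq ys zs ysI assms by simp
  qed
qed

text \<open>The lengths cannot agree, because \<open>s i\<close> is an inversion of exactly one of
  \<open>w\<close> and \<open>s i \<cdot> w\<close>.\<close>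

lemma len_s_mul_cases:
  assumes "i \<in> I" "w \<in> carrier G"
  shows "len (s i \<cdot> w) = Suc (len w) \<or> len w = Suc (len (s i \<cdot> w))"
proof -
  obtain xs where xs: "xs \<in> lists I" "el xs = w" using el_obtain_word[OF assms(2)] .
  show ?thesis
  proof (cases "inversion xs (s i)")
    case True
    then show ?thesis
      using inversion_iff_descent[OF xs(1) assms(1)] len_le_s_mul[OF assms] xs by simp
  next
    case False
    then have "inversion (i # xs) (s i)" using assms by (simp add: s_s)
    then show ?thesis
      using inversion_iff_descent[of "i # xs" i] len_s_mul_le[OF assms] xs assms
      by (simp add: el_Cons)
  qed
qed

lemma exchange:
  assumes "xs \<in> lists I" "i \<in> I" "len (s i \<cdot> el xs) < len (el xs)"
  shows "\<exists>k<length xs. s i \<cdot> el xs = el (take k xs @ drop (Suc k) xs) \<and>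
    s i = el (take k xs @ [xs ! k] @ rev (take k xs))"
  using inversion_exchange[of xs "s i"] inversion_iff_descent[of xs i] assms by simp

section \<open>The geometric representation\<close>

text \<open>The contragredient of Tits' geometric representation: \<open>f k\<close> is the value of the linear
  form \<open>f\<close> at the simple root of \<open>k\<close>.\<close>

definition cartan :: "'i \<Rightarrow> 'i \<Rightarrow> real" where
  "cartan i j = (case M i j of enat m \<Rightarrow> - 2 * cos (pi / m) | \<infinity> \<Rightarrow> - 2)"

definition reflect :: "'i \<Rightarrow> ('i \<Rightarrow> real) \<Rightarrow> 'i \<Rightarrow> real" where
  "reflect i f = (\<lambda>k. f k - cartan i k * f i)"

abbreviation act :: "'i list \<Rightarrow> ('i \<Rightarrow> real) \<Rightarrow> 'i \<Rightarrow> real" where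
  "act \<equiv> foldr reflect"

lemma cartan_refl: "i \<in> I \<Longrightarrow> cartan i i = 2"
  by (simp add: cartan_def M_refl)

lemma cartan_sym: "i \<in> I \<Longrightarrow> j \<in> I \<Longrightarrow> cartan i j = cartan j i"
  by (simp add: cartan_def M_sym)

lemma sin_add_eq_sin_diff: "sin (x + y) = sin (x - y) + 2 * cos x * sin y" for x y :: real
  by (simp add: sin_add sin_diff)

text \<open>In the plane of \<open>f i\<close> and \<open>f j\<close>, written through sines, one
  step s_i s_j shifts both angles by \<open>- 2 * \<theta>\<close>. Two terms are carried along
  because two independent phases are needed to reach every pair of values.\<close>

lemma act_alternating_rotation:
  assumes ij: "i \<in> I" "j \<in> I" and "cartan i j = - 2 * cos \<theta>"
    and f: "f i = p * sin \<phi> + q * sin \<psi>" "f j = p * sin (\<theta> - \<phi>) + q * sin (\<theta> - \<psi>)"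
  shows "act (alternating_word i j (2 * n)) f i = p * sin (\<phi> - 2 * n * \<theta>) + q * sin (\<psi> - 2 * n * \<theta>) \<and>
    act (alternating_word i j (2 * n)) f j
      = p * sin (\<theta> - (\<phi> - 2 * n * \<theta>)) + q * sin (\<theta> - (\<psi> - 2 * n * \<theta>))"
proof (induction n)
  case (Suc n)
  define g where "g = act (alternating_word i j (2 * n)) f"
  define a b where "a = \<phi> - 2 * n * \<theta>" and "b = \<psi> - 2 * n * \<theta>"
  have ab: "\<phi> - 2 * real (Suc n) * \<theta> = a - 2 * \<theta>" "\<psi> - 2 * real (Suc n) * \<theta> = b - 2 * \<theta>"
    by (simp_all add: a_def b_def algebra_simps)
  have g: "g i = p * sin a + q * sin b" "g j = p * sin (\<theta> - a) + q * sin (\<theta> - b)"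
    using Suc by (simp_all add: g_def a_def b_def)
  have c: "cartan i i = 2" "cartan j j = 2" "cartan i j = - 2 * cos \<theta>" "cartan j i = - 2 * cos \<theta>"
    using assms cartan_sym[of i j] by (simp_all add: cartan_refl)
  have sin1: "sin (x - 2 * \<theta>) = - (sin x + 2 * cos \<theta> * sin (\<theta> - x))" for x
    using sin_add_eq_sin_diff[of \<theta> "\<theta> - x"] sin_minus[of "2 * \<theta> - x"] by simp
  have sin2: "sin (\<theta> - (x - 2 * \<theta>))
      = - sin (\<theta> - x) + 2 * cos \<theta> * (sin x + 2 * cos \<theta> * sin (\<theta> - x))" for x
    using sin_add_eq_sin_diff[of \<theta> "\<theta> - (x - \<theta>)"] sin_add_eq_sin_diff[of \<theta> "\<theta> - x"]
      sin_minus[of "\<theta> - x"] by (simp add: algebra_simps)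
  have act: "act (alternating_word i j (2 * Suc n)) f = reflect i (reflect j g)" by (simp add: g_def)
  have "reflect i (reflect j g) i = p * - (sin a + 2 * cos \<theta> * sin (\<theta> - a))
      + q * - (sin b + 2 * cos \<theta> * sin (\<theta> - b))"
    by (simp add: reflect_def g c algebra_simps)
  moreover have "reflect i (reflect j g) j
      = p * (- sin (\<theta> - a) + 2 * cos \<theta> * (sin a + 2 * cos \<theta> * sin (\<theta> - a)))
      + q * (- sin (\<theta> - b) + 2 * cos \<theta> * (sin b + 2 * cos \<theta> * sin (\<theta> - b)))"
    by (simp add: reflect_def g c algebra_simps)
  ultimately show ?case unfolding act ab sin1 sin2 by blast
qed (use f in auto)

text \<open>The case of an infinite entry: the pair of values drifts linearly instead of rotating,
  so it never returns.\<close>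

lemma act_alternating_translation:
  assumes "i \<in> I" "j \<in> I" "cartan i j = - 2" "f i = 0" "f j = 1"
  shows "act (alternating_word i j (2 * n)) f i = - 2 * real n \<and>
    act (alternating_word i j (2 * n)) f j = 1 + 2 * real n"
proof (induction n)
  case (Suc n)
  then show ?case using assms cartan_sym[of i j] by (simp add: reflect_def cartan_refl)
qed (use assms in auto)

lemma rotation_coordinates:
  assumes "sin \<theta> \<noteq> (0::real)"
  shows "\<exists>p q. x = p * sin 0 + q * sin \<theta> \<and> y = p * sin (\<theta> - 0) + q * sin (\<theta> - \<theta>)"
  using assms by (intro exI[of _ "y / sin \<theta>"] exI[of _ "x / sin \<theta>"]) simp

text \<open>Both reflections fix a linear form \<open>f\<^sub>k + a f\<^sub>i + b f\<^sub>j\<close>, so it suffices to follow the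
  rotation in the plane of \<open>f\<^sub>i\<close> and \<open>f\<^sub>j\<close>.\<close>

lemma act_relation:
  assumes ij: "i \<in> I" "j \<in> I" "i \<noteq> j" and m: "M i j = enat m"
  shows "act (alternating_word i j (2 * m)) f = f"
proof
  fix k
  define \<theta> where "\<theta> = pi / m"
  have "2 \<le> m" using M_enat_ge_2 ij m by blast
  then have \<theta>: "0 < \<theta>" "\<theta> < pi" "2 * real m * \<theta> = 2 * pi" by (simp_all add: \<theta>_def field_simps)
  then have sin: "sin \<theta> \<noteq> 0" using sin_gt_zero by fastforce
  have cij: "cartan i j = - 2 * cos \<theta>" by (simp add: cartan_def m \<theta>_def)
  define c where "c = cartan i j"
  \<comment> \<open>The rank two Cartan matrix with off-diagonal entry \<open>c\<close> has
    determinant \<open>4 - c\<^sup>2\<close>. It is nonzero because \<open>2 \<le> m\<close> keeps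
    \<theta> strictly between 0 and pi.\<close>
  have "c\<^sup>2 + 4 * (sin \<theta>)\<^sup>2 = 4" 
    by (simp add: c_def cij cos_squared_eq)
  then have det: "4 - c\<^sup>2 \<noteq> 0" using sin by auto
  \<comment> \<open>Cramer's rule for the two equations \<open>ab\<close>, which express that both
    reflections fix \<open>g\<close>.\<close>
  define a where "a = (c * cartan j k - 2 * cartan i k) / (4 - c\<^sup>2)"
  define b where "b = (c * cartan i k - 2 * cartan j k) / (4 - c\<^sup>2)"
  have ab: "cartan i k + 2 * a + b * c = 0" "cartan j k + 2 * b + a * c = 0"
    using det by (simp_all add: a_def b_def field_simps power2_eq_square)
  define g where "g h = h k + a * h i + b * h j" for h :: "'i \<Rightarrow> real"
  have "g (reflect i h) = g h - (cartan i k + 2 * a + b * c) * h i"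
    "g (reflect j h) = g h - (cartan j k + 2 * b + a * c) * h j" for h
    using ij cartan_sym[of i j]
    by (simp_all add: g_def reflect_def cartan_refl c_def algebra_simps)
  then have "g (reflect i h) = g h" "g (reflect j h) = g h" for h by (simp_all add: ab)
  then have "g (act (alternating_word i j (2 * n)) h) = g h" for n h by (induction n) auto
  moreover obtain p q where "f i = p * sin 0 + q * sin \<theta>" "f j = p * sin (\<theta> - 0) + q * sin (\<theta> - \<theta>)"
    using rotation_coordinates[OF sin] by blast
  \<comment> \<open>By \<open>\<theta>(3)\<close> the total shift of each angle is a full
    turn.\<close>
  then have "act (alternating_word i j (2 * m)) f i = f i \<and> act (alternating_word i j (2 * m)) f j = f j"
    using act_alternating_rotation[OF ij(1,2) cij, of f p 0 q \<theta> m] unfolding \<theta>(3)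
    by (simp add: sin_diff sin_add)
  ultimately show "act (alternating_word i j (2 * m)) f k = f k"
    by (metis add_right_cancel g_def)
qed

lemma reflect_reflect:
  assumes "i \<in> I" shows "reflect i (reflect i f) = f"
  using assms by (auto simp: reflect_def cartan_refl algebra_simps)

lemma act_cong:
  assumes "word_cong I (coxeter_relations I M) xs ys"
  shows "act xs = act ys"
  using assms
proof (induction rule: word_cong.induct)
  case (rel u v xs ys)
  obtain i j m where uv: "u = alternating_word i j (2 * m)" "v = []" "i \<in> I" "j \<in> I" "M i j = enat m"
    using rel unfolding coxeter_relations_def by (auto simp: concat_replicate_pair)
  have "act u = id"
  proof (cases "i = j")
    case True
    then have "m = 1" using uv M_refl[of i] by simp
    then show ?thesis using uv True reflect_reflect by (auto simp: numeral_2_eq_2)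
  next
    case False
    then show ?thesis using act_relation[of i j m] uv by auto
  qed
  then show ?case using uv(2) by (simp only: foldr_append) simp
qed auto

text \<open>A linear form vanishing at the root of \<open>i\<close> but not at that of
  \<open>j\<close> is moved. For finite \<open>m\<close> its return after \<open>d\<close> steps
  would force \<open>cos (2 * (d * \<theta>)) = 1\<close>, although \<open>d * \<theta>\<close> lies
  strictly between 0 and pi; for an infinite entry the drift is nonzero.\<close>

lemma alternating_ne_one:
  assumes ij: "i \<in> I" "j \<in> I" "i \<noteq> j" and d: "0 < d" "enat d < M i j"
  shows "el (alternating_word i j (2 * d)) \<noteq> \<one>\<^bsub>G\<^esub>"
proof
  assume "el (alternating_word i j (2 * d)) = \<one>\<^bsub>G\<^esub>"
  then have act: "act (alternating_word i j (2 * d)) f = f" for f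
    using act_cong[of "alternating_word i j (2 * d)" "[]"] ij
      el_eq_iff[of "alternating_word i j (2 * d)" "[]"] by simp
  show False
  proof (cases "M i j")
    case (enat m)
    define \<theta> where "\<theta> = pi / m"
    define f where "f = (\<lambda>k. if k = j then sin \<theta> else 0)"
    have dm: "0 < d" "d < m" using d enat by auto
    then have \<theta>: "0 < d * \<theta>" "d * \<theta> < pi" "0 < \<theta>" "\<theta> \<le> d * \<theta>" by (simp_all add: \<theta>_def field_simps)
    have sin: "sin \<theta> > 0" "sin (d * \<theta>) > 0" using \<theta> order.strict_trans1[OF \<theta>(4,2)]
      by (auto intro!: sin_gt_zero)
    have cij: "cartan i j = - 2 * cos \<theta>" by (simp add: cartan_def enat \<theta>_def)
    have "sin (- (2 * (d * \<theta>))) = 0" "sin (\<theta> + 2 * (d * \<theta>)) = sin \<theta>"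
      using act_alternating_rotation[OF ij(1,2) cij, of f 1 0 0 0 d] act ij
      by (simp_all add: f_def mult.assoc)
    then have "sin \<theta> * cos (2 * (d * \<theta>)) = sin \<theta>" by (simp add: sin_add)
    then have "cos (2 * (d * \<theta>)) = 1" using sin by simp
    then show False using sin by (simp add: cos_double_sin)
  next
    case infinity
    define f :: "'i \<Rightarrow> real" where "f = (\<lambda>k. if k = j then 1 else 0)"
    have "cartan i j = - 2" by (simp add: cartan_def infinity)
    then show False
      using act_alternating_translation[of i j f d] act ij d by (simp add: f_def)
  qed
qed

lemma len_s: "i \<in> I \<Longrightarrow> len (s i) = 1"
  using len_s_mul_cases[of i "\<one>\<^bsub>G\<^esub>"] by auto

section \<open>Matsumoto's theorem\<close>

lemma reduced_if_length_le: "xs \<in> lists I \<Longrightarrow> length xs \<le> len (el xs) \<Longrightarrow> reduced xs"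
  using len_el_le[of xs] by (simp add: reduced_def)

lemma reduced_append:
  assumes "reduced (xs @ ys)" shows "reduced xs" "reduced ys"
proof -
  have "len (el (xs @ ys)) \<le> len (el xs) + len (el ys)"
    using assms len_mul_le[of "el xs" "el ys"] by (auto simp: reduced_def el_append)
  moreover have "len (el xs) \<le> length xs" "len (el ys) \<le> length ys"
    using assms by (auto simp: reduced_def intro: len_el_le)
  ultimately show "reduced xs" "reduced ys" using assms by (auto simp: reduced_def)
qed

lemma reduced_Cons: "reduced (i # xs) \<Longrightarrow> reduced xs"
  using reduced_append(2)[of "[i]" xs] by simp

lemma reduced_Nil [simp]: "reduced []" by (simp add: reduced_def)

lemma reduced_singleton: "i \<in> I \<Longrightarrow> reduced [i]"
  by (simp add: reduced_def len_s flip: s_eq)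

lemma reduced_rev: "reduced xs \<Longrightarrow> reduced (rev xs)"
  by (auto simp: reduced_def simp flip: inv_el)

lemma descent_obtain_reduced:
  assumes "w \<in> carrier G" "i \<in> I" "len (s i \<cdot> w) < len w"
  obtains xs where "reduced (i # xs)" "el (i # xs) = w"
proof -
  obtain xs where xs: "reduced xs" "el xs = s i \<cdot> w" using obtain_reduced[of "s i \<cdot> w"] assms by auto
  have "el (i # xs) = w" using xs reduced_in_lists[OF xs(1)] assms by (simp add: el_Cons)
  moreover have "reduced (i # xs)"
    using xs assms len_s_mul_cases[OF assms(2,1)] calculation by (auto simp: reduced_def)
  ultimately show ?thesis using that by blast
qed

lemma el_braid:
  assumes "i \<in> I" "j \<in> I" "M i j = enat m"
  shows "el (alternating_word i j m) = el (alternating_word j i m)"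
proof -
  have "el (alternating_word i j m) \<cdot> inv\<^bsub>G\<^esub> el (alternating_word j i m) = \<one>\<^bsub>G\<^esub>"
    using el_relation[OF assms] assms
    by (simp add: inv_el alternating_word_append_rev flip: el_append)
  then show ?thesis using assms G.inv_equality[of "el (alternating_word i j m)" "inv\<^bsub>G\<^esub> el (alternating_word j i m)"]
    by simp
qed

text \<open>A prefix starting with \<open>j\<close> is lengthened by prepending \<open>i\<close>:
  since \<open>i\<close> is a descent, exchange deletes a letter of the reduced word, and the order
  of s_i s_j forces that letter to lie behind the prefix. The induction alternates the roles of
  \<open>i\<close> and \<open>j\<close>.\<close>

lemma two_descents_prefix:
  assumes "w \<in> carrier G" "i \<in> I" "j \<in> I" "i \<noteq> j" "len (s i \<cdot> w) < len w" "len (s j \<cdot> w) < len w"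
    "enat n \<le> M i j"
  shows "\<exists>ys. reduced (alternating_word i j n @ ys) \<and> el (alternating_word i j n @ ys) = w"
  using assms
proof (induction n arbitrary: i j)
  case 0
  then show ?case using obtain_reduced[of w] by auto
next
  case (Suc n)
  have "enat n \<le> M j i"
    using Suc.prems M_sym[of i j] by (metis Suc_ile_eq order.strict_implies_order)
  then obtain ys where ys: "reduced (alternating_word j i n @ ys)" "el (alternating_word j i n @ ys) = w"
    using Suc.IH[of j i] Suc.prems by auto
  define xs where "xs = alternating_word j i n @ ys"
  have I: "xs \<in> lists I" "ys \<in> lists I" using ys by (auto simp: xs_def)
  obtain k where k: "k < length xs" "s i \<cdot> w = el (take k xs @ drop (Suc k) xs)"
    "s i = el (take k xs @ [xs ! k] @ rev (take k xs))"
    using exchange[OF I(1), of i] Suc.prems ys(2) by (auto simp: xs_def)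
  \<comment> \<open>A deletion inside the prefix would make \<open>s i\<close> an alternating
    product of \<open>2 * k + 1\<close> letters starting with \<open>j\<close>, so that the power
    \<open>Suc k\<close> of s_i s_j would be trivial below the order \<open>M i j\<close>.\<close>
  have "n \<le> k"
  proof (rule ccontr)
    assume "\<not> n \<le> k"
    then have "k < n" by simp
    then have "take k xs = alternating_word j i k" "xs ! k = (if even k then j else i)"
      by (simp_all add: xs_def take_alternating_word nth_append nth_alternating_word)
    then have "s i = el (alternating_word j i (2 * k + 1))"
      using k(3) by (simp only: alternating_word_palindrome)
    then have "s i \<cdot> s i = el (alternating_word i j (2 * Suc k))"
      using el_Cons[of i "alternating_word j i (2 * k + 1)"] Suc.prems by simp
    moreover have "enat (Suc k) < M i j"
      using Suc.prems(7) \<open>k < n\<close> by (metis Suc_less_eq enat_ord_simps(2) order.strict_trans2)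
    ultimately show False using alternating_ne_one[of i j "Suc k"] Suc.prems s_s[of i] by simp
  qed
  define zs where "zs = take (k - n) ys @ drop (Suc (k - n)) ys"
  have zs: "zs \<in> lists I" using I(2) by (simp add: zs_def)
  have "take k xs @ drop (Suc k) xs = alternating_word j i n @ zs"
    using \<open>n \<le> k\<close> by (simp add: xs_def zs_def Suc_diff_le)
  then have "w = s i \<cdot> el (alternating_word j i n @ zs)" using k(2) Suc.prems by (metis s_s_mul)
  then have w: "w = el (alternating_word i j (Suc n) @ zs)" using zs Suc.prems by (simp add: el_Cons)
  \<comment> \<open>One letter is deleted and one prepended, so the new word is as short as the
    reduced one.\<close>
  have "length (alternating_word i j (Suc n) @ zs) = length xs"
    using \<open>n \<le> k\<close> k(1) by (simp add: zs_def xs_def)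
  then have "reduced (alternating_word i j (Suc n) @ zs)"
    using ys w zs Suc.prems by (auto simp: reduced_def xs_def)
  then show ?case using w by blast
qed

lemma two_descents:
  assumes "w \<in> carrier G" "i \<in> I" "j \<in> I" "i \<noteq> j" "len (s i \<cdot> w) < len w" "len (s j \<cdot> w) < len w"
  obtains m ys where "M i j = enat m" "ys \<in> lists I" "reduced (alternating_word i j m @ ys)"
    "el (alternating_word i j m @ ys) = w"
proof -
  \<comment> \<open>Otherwise a reduced word of \<open>w\<close> could begin with an alternating
    prefix longer than \<open>len w\<close>.\<close>
  have "M i j \<noteq> \<infinity>"
  proof
    assume "M i j = \<infinity>"
    then obtain ys where "reduced (alternating_word i j (Suc (len w)) @ ys)"
      "el (alternating_word i j (Suc (len w)) @ ys) = w"
      using two_descents_prefix[OF assms, of "Suc (len w)"] by auto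
    then show False unfolding reduced_def by simp
  qed
  then obtain m where m: "M i j = enat m" by auto
  then obtain ys where "reduced (alternating_word i j m @ ys)" "el (alternating_word i j m @ ys) = w"
    using two_descents_prefix[OF assms, of m] by auto
  then show ?thesis using that[OF m, of ys] by (auto dest: reduced_in_lists)
qed

abbreviation hecke_cong where "hecke_cong \<equiv> word_cong I (hecke_relations I M)"

lemma hecke_cong_braid:
  assumes "i \<in> I" "j \<in> I" "i \<noteq> j" "M i j = enat m" "ys \<in> lists I"
  shows "hecke_cong (alternating_word i j m @ ys) (alternating_word j i m @ ys)"
proof -
  have "(alternating_word i j m, alternating_word j i m) \<in> hecke_relations I M"
    using assms unfolding hecke_relations_def by blast
  from word_cong.rel[OF this, of I "[]" ys] show ?thesis using assms by simp
qed

lemma hecke_cong_idem: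
  assumes "i \<in> I" "xs \<in> lists I" "ys \<in> lists I"
  shows "hecke_cong (xs @ i # i # ys) (xs @ i # ys)"
proof -
  have "([i, i], [i]) \<in> hecke_relations I M"
    using assms unfolding hecke_relations_def by blast
  from word_cong.rel[OF this, of I xs ys] show ?thesis using assms by simp
qed

text \<open>If the first letters \<open>i\<close> and \<open>j\<close> differ, both are descents, so
  the element has reduced words starting with either side of the braid relation. Induction on the
  tails joins \<open>xs\<close> to one and \<open>ys\<close> to the other, and a single braid move
  joins these two.\<close>

theorem matsumoto:
  assumes "reduced xs" "reduced ys" "el xs = el ys"
  shows "hecke_cong xs ys"
  using assms
proof (induction "length xs" arbitrary: xs ys)
  case 0
  then have "xs = []" "ys = []" by (metis length_0_conv reduced_def)+
  then show ?case by (simp add: word_cong.refl)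
next
  case (Suc n)
  have "length ys = Suc n" using Suc.hyps Suc.prems by (simp add: reduced_def)
  then obtain i xs' j ys' where eq: "xs = i # xs'" "ys = j # ys'"
    using Suc.hyps(2) by (metis length_Suc_conv)
  define w where "w = el xs"
  have I: "i \<in> I" "xs' \<in> lists I" "j \<in> I" "ys' \<in> lists I"
    using Suc.prems(1,2) eq by (auto dest!: reduced_in_lists)
  have red: "reduced xs'" "reduced ys'" using Suc.prems eq reduced_Cons by auto
  have w: "w \<in> carrier G" "w = s i \<cdot> el xs'" "w = s j \<cdot> el ys'"
    using I Suc.prems eq by (auto simp: w_def el_Cons)
  show ?case
  proof (cases "i = j")
    case True
    then have "el xs' = el ys'" using w I by (metis el_closed s_s_mul)
    then show ?thesis using Suc.hyps(1)[of xs' ys'] Suc.hyps(2) red True I eq by (auto intro: word_cong_Cons)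
  next
    case False
    have sw: "s i \<cdot> w = el xs'" "s j \<cdot> w = el ys'" using w(2,3) I by (metis el_closed s_s_mul)+
    have "len w = Suc n" using Suc.hyps Suc.prems by (simp add: w_def reduced_def)
    then have "len (s i \<cdot> w) < len w" "len (s j \<cdot> w) < len w"
      unfolding sw using len_el_le[of xs'] len_el_le[of ys'] I eq Suc.hyps(2) \<open>length ys = Suc n\<close> by auto
    then obtain m zs where m: "M i j = enat m" and zs: "zs \<in> lists I"
      "reduced (alternating_word i j m @ zs)" "el (alternating_word i j m @ zs) = w"
      using two_descents[OF w(1) I(1,3) False] by blast
    have zs': "el (alternating_word j i m @ zs) = w"
      using zs el_braid[OF I(1,3) m] I by (simp add: el_append)
    then have red': "reduced (alternating_word j i m @ zs)" using zs I by (simp add: reduced_def)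
    obtain m' where m': "m = Suc m'" using M_enat_ge_2[OF I(1,3) False m] by (cases m) auto
    have "reduced (alternating_word j i m' @ zs)" "reduced (alternating_word i j m' @ zs)"
      using zs(2) red' reduced_Cons unfolding m' by auto
    moreover have "w = s i \<cdot> el (alternating_word j i m' @ zs)" "w = s j \<cdot> el (alternating_word i j m' @ zs)"
      using zs(1,3) zs' I unfolding m' by (simp_all add: el_Cons)
    then have "el xs' = el (alternating_word j i m' @ zs)" "el ys' = el (alternating_word i j m' @ zs)"
      using sw zs(1) I by (metis s_s_mul el_closed append_in_lists_conv alternating_word_in_lists)+
    ultimately have "hecke_cong xs' (alternating_word j i m' @ zs)" "hecke_cong ys' (alternating_word i j m' @ zs)"
      using Suc.hyps(1)[of xs'] Suc.hyps(1)[of ys'] red Suc.hyps(2) \<open>length ys = Suc n\<close> eq by auto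
    then have "hecke_cong xs (alternating_word i j m @ zs)" "hecke_cong ys (alternating_word j i m @ zs)"
      using I unfolding eq m' by (auto intro: word_cong_Cons)
    then show ?thesis using hecke_cong_braid[OF I(1,3) False m zs(1)]
      by (meson word_cong.sym word_cong.trans)
  qed
qed

section \<open>The Hecke monoid on the Coxeter group\<close>

text \<open>The elements represented by the subwords of a word. Unlike the element itself, this set is
  invariant under the Hecke relations, and it determines the element represented by a reduced word.\<close>

fun subword_elts :: "'i list \<Rightarrow> 'i list set set" where
  "subword_elts [] = {\<one>\<^bsub>G\<^esub>}"
| "subword_elts (i # xs) = subword_elts xs \<union> (\<lambda>w. s i \<cdot> w) ` subword_elts xs"

lemma subword_elts_closed: "xs \<in> lists I \<Longrightarrow> subword_elts xs \<subseteq> carrier G"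
  by (induction xs) auto

lemma subword_elts_append:
  assumes "xs \<in> lists I" "ys \<in> lists I"
  shows "subword_elts (xs @ ys) = (\<Union>a\<in>subword_elts xs. (\<lambda>b. a \<cdot> b) ` subword_elts ys)"
  using assms
proof (induction xs)
  case Nil
  then show ?case using subword_elts_closed[of ys] by (auto simp: image_iff subset_iff)
next
  case (Cons i xs)
  have closed: "i \<in> I" "subword_elts xs \<subseteq> carrier G" "subword_elts ys \<subseteq> carrier G"
    using Cons subword_elts_closed by auto
  have "(\<lambda>w. s i \<cdot> w) ` (\<Union>a\<in>subword_elts xs. (\<lambda>b. a \<cdot> b) ` subword_elts ys)
    = (\<Union>a\<in>subword_elts xs. (\<lambda>b. s i \<cdot> a \<cdot> b) ` subword_elts ys)"
    unfolding image_UN image_image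
    using closed by (intro SUP_cong image_cong) (simp_all add: G.m_assoc subset_iff)
  then show ?case using Cons by auto
qed

text \<open>A subword of an alternating word collapses to an alternating word. The list is symmetric
  in \<open>i\<close> and \<open>j\<close> except at the full length \<open>n\<close>, where only
  the word starting with \<open>i\<close> occurs.\<close>

lemma subword_elts_alternating:
  assumes "i \<in> I" "j \<in> I"
  shows "subword_elts (alternating_word i j n) =
    (\<lambda>k. el (alternating_word i j k)) ` {..n} \<union> (\<lambda>k. el (alternating_word j i k)) ` {..<n}"
  using assms
proof (induction n arbitrary: i j)
  case (Suc n)
  let ?a = "\<lambda>k. el (alternating_word i j k)" and ?b = "\<lambda>k. el (alternating_word j i k)"
  have b: "s i \<cdot> ?b k = ?a (Suc k)" for k using Suc.prems by (simp add: el_Cons)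
  have a: "s i \<cdot> ?a (Suc k) = ?b k" for k using Suc.prems by (simp add: el_Cons)
  have a0: "s i \<cdot> ?a 0 = ?a (Suc 0)" using Suc.prems by (simp add: el_Cons)
  \<comment> \<open>\<open>B\<close> and \<open>A\<close> are the elements of the tail starting with
    \<open>j\<close> and with \<open>i\<close>. Multiplying by \<open>s i\<close> lengthens those in
    \<open>B\<close>, giving \<open>C\<close>, and cancels the first letter of those in
    \<open>A\<close>, giving \<open>S\<close>; only the empty word in \<open>A\<close> is
    lengthened.\<close>
  define A B C S where "A = ?a ` {..<n}" and "B = ?b ` {..n}" and "C = ?a ` Suc ` {..n}"
    and "S = (\<lambda>w. s i \<cdot> w) ` A"
  have "(\<lambda>w. s i \<cdot> w) ` B = C" by (simp add: B_def C_def image_image b)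
  then have eq: "subword_elts (alternating_word i j (Suc n)) = B \<union> A \<union> (C \<union> S)"
    using Suc.IH[of j i] Suc.prems by (simp add: A_def B_def S_def image_Un)
  have "{..Suc n} = insert 0 (Suc ` {..n})" by (rule atMost_Suc_eq_insert_0)
  then have C: "?a ` {..Suc n} = insert (?a 0) C" by (simp add: C_def)
  have "S \<subseteq> insert (?a (Suc 0)) B"
  proof
    fix x assume "x \<in> S"
    then obtain k where "k < n" "x = s i \<cdot> ?a k" by (auto simp: S_def A_def)
    then show "x \<in> insert (?a (Suc 0)) B" using a a0 by (cases k) (auto simp: B_def)
  qed
  moreover have "A \<subseteq> insert (?a 0) C" unfolding C[symmetric] A_def by auto
  moreover have "?a (Suc 0) \<in> C" unfolding C_def by (intro imageI) simp
  moreover have "?b 0 \<in> B" unfolding B_def by (intro imageI) simp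
  then have "?a 0 \<in> B" by simp
  ultimately show ?case unfolding eq C lessThan_Suc_atMost B_def[symmetric] by blast
qed simp

text \<open>By the product formula it suffices to compare the two sides of a relation. For a braid
  relation the only asymmetric elements are the two of length \<open>m\<close>, and these are equal
  in the group.\<close>

lemma subword_elts_cong:
  assumes "hecke_cong xs ys" shows "subword_elts xs = subword_elts ys"
  using assms
proof (induction rule: word_cong.induct)
  case (rel u v xs ys)
  consider i where "u = [i, i]" "v = [i]" "i \<in> I"
    | i j m where "u = alternating_word i j m" "v = alternating_word j i m" "i \<in> I" "j \<in> I" "M i j = enat m"
    using rel(1) unfolding hecke_relations_def by blast
  then have "subword_elts u = subword_elts v"
  proof cases
    case 1
    then show ?thesis by (auto simp: s_s)
  next
    case (2 i j m)
    have "{..m} = insert m {..<m}" by auto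
    then show ?thesis
      using 2 el_braid[OF 2(3-5)] by (simp add: subword_elts_alternating) blast
  qed
  then show ?case using rel by (simp add: subword_elts_append)
qed auto

lemma el_in_subword_elts: "xs \<in> lists I \<Longrightarrow> el xs \<in> subword_elts xs"
  by (induction xs) (auto simp: el_Cons)

lemma subword_elts_len:
  assumes "xs \<in> lists I" "w \<in> subword_elts xs"
  shows "len w \<le> length xs \<and> (len w = length xs \<longrightarrow> w = el xs)"
  using assms
proof (induction xs arbitrary: w)
  case (Cons i xs)
  then consider "w \<in> subword_elts xs" | v where "w = s i \<cdot> v" "v \<in> subword_elts xs" by auto
  then show ?case
  proof cases
    case 1
    then show ?thesis using Cons by fastforce
  next
    case 2
    have I: "i \<in> I" "xs \<in> lists I" using Cons by auto
    then have "v \<in> carrier G" using subword_elts_closed[of xs] 2 by auto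
    then show ?thesis using Cons.IH[of v] 2 I len_s_mul_le[of i v] by (auto simp: el_Cons)
  qed
qed auto

text \<open>Each of the two elements is a subword element of the other word, so the lengths agree
  and maximality of length identifies them. This is injectivity of the map from the Coxeter group to
  the presented monoid.\<close>

lemma hecke_cong_reduced_imp_el_eq:
  assumes "reduced xs" "reduced ys" "hecke_cong xs ys"
  shows "el xs = el ys"
proof -
  have I: "xs \<in> lists I" "ys \<in> lists I" using assms by auto
  have "el xs \<in> subword_elts ys" "el ys \<in> subword_elts xs"
    using el_in_subword_elts I subword_elts_cong[OF assms(3)] by auto
  then show ?thesis using subword_elts_len I assms(1,2) by (metis reduced_def le_antisym)
qed

text \<open>Surjectivity of that map. When prepending \<open>i\<close> shortens the element,
  Matsumoto's theorem moves an \<open>i\<close> to the front of the reduced word, and the doubled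
  letter is contracted.\<close>

lemma hecke_cong_reduced:
  assumes "xs \<in> lists I"
  obtains ys where "reduced ys" "hecke_cong xs ys"
proof -
  have "\<exists>ys. reduced ys \<and> hecke_cong xs ys"
    using assms
  proof (induction xs)
    case Nil
    then show ?case by (auto intro!: exI[of _ "[]"] word_cong.refl)
  next
    case (Cons i xs)
    then obtain ys where ys: "reduced ys" "hecke_cong xs ys" by auto
    have I: "i \<in> I" "xs \<in> lists I" "ys \<in> lists I" using Cons ys by auto
    have cong: "hecke_cong (i # xs) (i # ys)" using I ys by (auto intro: word_cong_Cons)
    show ?case
    proof (cases "len (s i \<cdot> el ys) < len (el ys)")
      case True
      then obtain zs where zs: "reduced (i # zs)" "el (i # zs) = el ys"
        using descent_obtain_reduced[of "el ys" i] I by auto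
      have "zs \<in> lists I" using zs by (auto dest: reduced_in_lists)
      have c: "hecke_cong ys (i # zs)" using matsumoto[OF ys(1) zs(1)] zs(2) by simp
      have "hecke_cong (i # ys) (i # i # zs)" using c I by (auto intro: word_cong_Cons)
      moreover have "hecke_cong (i # i # zs) (i # zs)"
        using hecke_cong_idem[of i "[]" zs] I \<open>zs \<in> lists I\<close> by simp
      ultimately show ?thesis using cong zs(1) word_cong.trans by blast
    next
      case False
      then have "reduced (i # ys)"
        using len_s_mul_cases[of i "el ys"] I ys by (auto simp: reduced_def el_Cons)
      then show ?thesis using cong by blast
    qed
  qed
  then show ?thesis using that by blast
qed

section \<open>The product transported to the group\<close>

abbreviation hecke where "hecke \<equiv> word_class I (hecke_relations I M)"
abbreviation H where "H \<equiv> hecke_monoid I M"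
abbreviation star (infixl "\<star>" 70) where "x \<star> y \<equiv> x \<otimes>\<^bsub>H\<^esub> y"

lemma hecke_eq_iff: "xs \<in> lists I \<Longrightarrow> hecke xs = hecke ys \<longleftrightarrow> hecke_cong xs ys"
  by (rule word_class_eq_iff)

lemma hecke_class_el:
  assumes "reduced xs" shows "hecke_class I M (el xs) = hecke xs"
proof -
  let ?P = "\<lambda>ys. ys \<in> el xs \<and> length ys = len (el xs)"
  have xs: "xs \<in> lists I" using assms by auto
  have "?P xs" using assms xs by (simp add: reduced_def word_class_def word_cong.refl)
  then have P: "?P (SOME ys. ?P ys)" by (rule someI)
  define ys where "ys = (SOME ys. ?P ys)"
  have "word_cong I (coxeter_relations I M) xs ys"
    using P unfolding ys_def word_class_def by blast
  then have eq: "el xs = el ys" "ys \<in> lists I" using el_eq_iff[OF xs] word_cong_in_lists by blast+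
  then have "reduced ys" using P unfolding ys_def[symmetric] by (simp add: reduced_def)
  then have "hecke_cong xs ys" using matsumoto assms eq by blast
  then show ?thesis using hecke_eq_iff[OF xs, of ys] by (simp add: hecke_class_def ys_def)
qed

text \<open>The Demazure product of the letters of a word. It allows computation with
  \<open>\<star>\<close> by concatenating words.\<close>

definition hecke_elt :: "'i list \<Rightarrow> 'i list set" where
  "hecke_elt xs = inv_into (carrier G) (hecke_class I M) (hecke xs)"

lemma hecke_class_inj: "inj_on (hecke_class I M) (carrier G)"
proof (rule inj_onI)
  fix v w assume vw: "v \<in> carrier G" "w \<in> carrier G" "hecke_class I M v = hecke_class I M w"
  obtain xs ys where r: "reduced xs" "el xs = v" "reduced ys" "el ys = w"
    using obtain_reduced vw(1,2) by metis
  then have "hecke xs = hecke ys" using vw(3) hecke_class_el by metis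
  then have "hecke_cong xs ys" using r hecke_eq_iff by auto
  then show "v = w" using hecke_cong_reduced_imp_el_eq r by blast
qed

lemma hecke_elt_eqI:
  assumes "reduced ys" "hecke_cong xs ys" shows "hecke_elt xs = el ys"
proof -
  have "hecke xs = hecke_class I M (el ys)"
    using assms word_cong_in_lists[OF assms(2)] by (simp add: hecke_class_el hecke_eq_iff)
  then show ?thesis
    using inv_into_f_f[OF hecke_class_inj, of "el ys"] assms by (auto simp: hecke_elt_def)
qed

lemma hecke_elt_reduced: "reduced xs \<Longrightarrow> hecke_elt xs = el xs"
  by (rule hecke_elt_eqI) (auto intro: word_cong.refl)

lemma hecke_elt_closed [simp]: "xs \<in> lists I \<Longrightarrow> hecke_elt xs \<in> carrier G"
  by (metis hecke_cong_reduced hecke_elt_eqI el_closed reduced_in_lists)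

lemma hecke_elt_cong: "hecke_cong xs ys \<Longrightarrow> hecke_elt xs = hecke_elt ys"
  using hecke_eq_iff word_cong_in_lists unfolding hecke_elt_def by metis

lemma hecke_class_hecke_elt:
  assumes "xs \<in> lists I" shows "hecke_class I M (hecke_elt xs) = hecke xs"
  using assms by (metis hecke_cong_reduced hecke_elt_eqI hecke_class_el hecke_eq_iff)

lemma hecke_elt_eq_iff:
  assumes "xs \<in> lists I" "ys \<in> lists I"
  shows "hecke_elt xs = hecke_elt ys \<longleftrightarrow> hecke_cong xs ys"
  using assms by (metis hecke_class_hecke_elt hecke_elt_cong hecke_eq_iff)

lemma hecke_elt_append:
  assumes "xs \<in> lists I" "ys \<in> lists I"
  shows "hecke_elt (xs @ ys) = hecke_elt xs \<star> hecke_elt ys"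
  using assms by (simp add: hecke_monoid_def hecke_class_hecke_elt word_class_mult hecke_elt_def[of "xs @ ys"])

lemma carrier_H [simp]: "carrier H = carrier G" and one_H [simp]: "\<one>\<^bsub>H\<^esub> = \<one>\<^bsub>G\<^esub>"
  by (simp_all add: hecke_monoid_def)

lemma hecke_elt_Nil [simp]: "hecke_elt [] = \<one>\<^bsub>G\<^esub>"
  by (simp add: hecke_elt_reduced)

lemma hecke_elt_singleton: "i \<in> I \<Longrightarrow> hecke_elt [i] = s i"
  by (simp add: hecke_elt_reduced reduced_singleton s_eq)

lemma hecke_elt_Cons: "i \<in> I \<Longrightarrow> xs \<in> lists I \<Longrightarrow> hecke_elt (i # xs) = s i \<star> hecke_elt xs"
  using hecke_elt_append[of "[i]" xs] by (simp add: hecke_elt_singleton)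

lemma obtain_hecke_elt:
  assumes "w \<in> carrier G"
  obtains xs where "xs \<in> lists I" "w = hecke_elt xs"
  using assms by (metis obtain_reduced hecke_elt_reduced reduced_in_lists)

lemma star_closed [simp, intro]: "v \<in> carrier G \<Longrightarrow> w \<in> carrier G \<Longrightarrow> v \<star> w \<in> carrier G"
  by (metis obtain_hecke_elt hecke_elt_append hecke_elt_closed append_in_lists_conv)

lemma star_assoc:
  assumes "u \<in> carrier G" "v \<in> carrier G" "w \<in> carrier G"
  shows "u \<star> v \<star> w = u \<star> (v \<star> w)"
proof -
  obtain xs ys zs where "xs \<in> lists I" "ys \<in> lists I" "zs \<in> lists I"
    "u = hecke_elt xs" "v = hecke_elt ys" "w = hecke_elt zs"
    using assms by (metis obtain_hecke_elt)
  then show ?thesis by (metis append_assoc append_in_lists_conv hecke_elt_append)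
qed

lemma one_star [simp]: "w \<in> carrier G \<Longrightarrow> \<one>\<^bsub>G\<^esub> \<star> w = w"
  by (metis append_Nil hecke_elt_Nil hecke_elt_append lists.Nil obtain_hecke_elt)

lemma star_one [simp]: "w \<in> carrier G \<Longrightarrow> w \<star> \<one>\<^bsub>G\<^esub> = w"
  by (metis append_Nil2 hecke_elt_Nil hecke_elt_append lists.Nil obtain_hecke_elt)

lemma star_eq_mul:
  assumes "v \<in> carrier G" "w \<in> carrier G" "len (v \<cdot> w) = len v + len w"
  shows "v \<star> w = v \<cdot> w"
proof -
  obtain xs ys where r: "reduced xs" "el xs = v" "reduced ys" "el ys = w"
    using obtain_reduced assms(1,2) by metis
  then have "reduced (xs @ ys)" using assms(3) by (auto simp: reduced_def el_append)
  then show ?thesis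
    using r hecke_elt_append[of xs ys] by (auto simp: hecke_elt_reduced el_append)
qed

text \<open>At a descent, \<open>w\<close> has a reduced word starting with \<open>i\<close>, and
  the doubled letter contracts; otherwise the lengths add.\<close>

lemma s_star:
  assumes "i \<in> I" "w \<in> carrier G"
  shows "s i \<star> w = (if len (s i \<cdot> w) < len w then w else s i \<cdot> w)"
proof (cases "len (s i \<cdot> w) < len w")
  case True
  then obtain xs where xs: "reduced (i # xs)" "el (i # xs) = w"
    using descent_obtain_reduced assms by blast
  then have I: "xs \<in> lists I" by (auto dest: reduced_in_lists)
  have w: "w = hecke_elt (i # xs)" using xs hecke_elt_reduced by simp
  have "s i \<star> w = hecke_elt (i # i # xs)" unfolding w using assms I by (simp add: hecke_elt_Cons)
  also have "\<dots> = w" unfolding w using hecke_elt_cong hecke_cong_idem[of i "[]" xs] assms I by simp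
  finally show ?thesis using True by simp
next
  case False
  then show ?thesis using star_eq_mul[of "s i" w] assms len_s_mul_cases[of i w] by (simp add: len_s)
qed

lemma len_mul_s: "i \<in> I \<Longrightarrow> w \<in> carrier G \<Longrightarrow> len (w \<cdot> s i) = len (s i \<cdot> inv\<^bsub>G\<^esub> w)"
  by (metis G.inv_mult_group G.m_closed inv_s len_inv s_closed)

lemma len_mul_s_cases:
  assumes "i \<in> I" "w \<in> carrier G"
  shows "len (w \<cdot> s i) = Suc (len w) \<or> len w = Suc (len (w \<cdot> s i))"
  using len_s_mul_cases[of i "inv\<^bsub>G\<^esub> w"] assms by (simp add: len_mul_s)

text \<open>The mirror image of \<open>s_star\<close>: a right descent of \<open>w\<close> is a left
  descent of its inverse, and reversing a reduced word of the inverse puts \<open>i\<close>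
  last.\<close>

lemma star_s:
  assumes "i \<in> I" "w \<in> carrier G"
  shows "w \<star> s i = (if len (w \<cdot> s i) < len w then w else w \<cdot> s i)"
proof (cases "len (w \<cdot> s i) < len w")
  case True
  then obtain xs where xs: "reduced (i # xs)" "el (i # xs) = inv\<^bsub>G\<^esub> w"
    using descent_obtain_reduced[of "inv\<^bsub>G\<^esub> w" i] assms by (auto simp: len_mul_s)
  define ys where "ys = rev xs"
  have I: "ys \<in> lists I" "i # xs \<in> lists I" using xs by (auto simp: ys_def dest: reduced_in_lists)
  have "el (ys @ [i]) = w" using inv_el[OF I(2)] xs(2) assms by (simp add: ys_def)
  then have w: "w = hecke_elt (ys @ [i])" using reduced_rev[OF xs(1)] hecke_elt_reduced by (simp add: ys_def)
  have "w \<star> s i = hecke_elt (ys @ [i, i])"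
    unfolding w using assms I hecke_elt_append[of "ys @ [i]" "[i]"] by (simp add: hecke_elt_singleton)
  also have "\<dots> = w" unfolding w using hecke_elt_cong hecke_cong_idem[of i ys "[]"] assms I by simp
  finally show ?thesis using True by simp
next
  case False
  then show ?thesis using star_eq_mul[of w "s i"] assms len_mul_s_cases[of i w] by (simp add: len_s)
qed

section \<open>Parabolic subgroups\<close>

abbreviation P where "P \<equiv> parabolic_subgroup I M"

lemma lists_mono_I: "J \<subseteq> I \<Longrightarrow> xs \<in> lists J \<Longrightarrow> xs \<in> lists I"
  using lists_mono by blast

lemma parabolic_eq:
  assumes "J \<subseteq> I" shows "P J = el ` lists J"
proof
  show "P J \<subseteq> el ` lists J"
  proof
    fix w assume "w \<in> P J"
    then show "w \<in> el ` lists J"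
      unfolding parabolic_subgroup_def
    proof (induction rule: generate.induct)
      case one
      then show ?case by (auto intro!: image_eqI[of _ _ "[]"])
    next
      case (incl h)
      then show ?case by (auto simp: s_eq)
    next
      case (inv h)
      then obtain j where "j \<in> J" "h = s j" by auto
      then show ?case using assms by (auto simp: subset_iff) (auto simp: s_eq)
    next
      case (eng h1 h2)
      then obtain xs ys where "xs \<in> lists J" "ys \<in> lists J" "h1 = el xs" "h2 = el ys" by blast
      then show ?case using lists_mono_I[OF assms] by (intro image_eqI[of _ _ "xs @ ys"]) (simp_all add: el_append)
    qed
  qed
  show "el ` lists J \<subseteq> P J"
  proof
    fix w assume "w \<in> el ` lists J"
    then obtain xs where xs: "xs \<in> lists J" "w = el xs" by blast
    have "el xs \<in> P J" using xs(1)
    proof (induction xs)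
      case Nil
      then show ?case by (simp add: parabolic_subgroup_def generate.one)
    next
      case (Cons i xs)
      then have "el (i # xs) = s i \<cdot> el xs"
        using assms lists_mono_I[of J xs] by (intro el_Cons) auto
      then show ?case using Cons by (auto simp: parabolic_subgroup_def intro: generate.eng generate.incl)
    qed
    then show "w \<in> P J" using xs by simp
  qed
qed

lemma parabolic_carrier: "J \<subseteq> I \<Longrightarrow> w \<in> P J \<Longrightarrow> w \<in> carrier G"
  using lists_mono_I by (auto simp: parabolic_eq)

lemma parabolic_I: "P I = carrier G"
  by (simp add: parabolic_eq carrier_eq)

lemma s_parabolic: "J \<subseteq> I \<Longrightarrow> j \<in> J \<Longrightarrow> s j \<in> P J"
  by (auto simp: parabolic_eq s_eq)

lemma one_parabolic: "J \<subseteq> I \<Longrightarrow> \<one>\<^bsub>G\<^esub> \<in> P J"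
  by (simp add: parabolic_subgroup_def generate.one)

lemma mul_parabolic: "v \<in> P J \<Longrightarrow> w \<in> P J \<Longrightarrow> v \<cdot> w \<in> P J"
  by (simp add: parabolic_subgroup_def generate.eng)

lemma inv_parabolic: "J \<subseteq> I \<Longrightarrow> w \<in> P J \<Longrightarrow> inv\<^bsub>G\<^esub> w \<in> P J"
  using inv_el lists_mono_I by (auto simp: parabolic_eq)

lemma parabolic_mono: "J \<subseteq> K \<Longrightarrow> P J \<subseteq> P K"
  unfolding parabolic_subgroup_def by (intro G.mono_generate) auto

text \<open>Since off-diagonal entries are at least 2, both letters occur on each side of a braid
  relation.\<close>

lemma hecke_cong_set:
  assumes "hecke_cong xs ys" shows "set xs = set ys"
  using assms
proof (induction rule: word_cong.induct)
  case (rel u v xs ys)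
  then have "set u = set v"
    using M_enat_ge_2 unfolding hecke_relations_def by (auto simp: set_alternating_word)
  then show ?case by simp
qed auto

text \<open>Exchange only deletes letters, so a word over \<open>J\<close> can be made reduced
  inside \<open>J\<close>. By Matsumoto's theorem every other reduced word of the element has the
  same set of letters.\<close>

lemma parabolic_reduced:
  assumes J: "J \<subseteq> I" and w: "w \<in> P J" and xs: "reduced xs" "el xs = w"
  shows "xs \<in> lists J"
proof -
  have "\<exists>zs\<in>lists J. reduced zs \<and> el zs = el ys" if "ys \<in> lists J" for ys
    using that
  proof (induction ys)
    case Nil
    then show ?case by (intro bexI[of _ "[]"]) auto
  next
    case (Cons i ys)
    then obtain zs where zs: "zs \<in> lists J" "reduced zs" "el zs = el ys" by auto
    have I: "i \<in> J" "i \<in> I" "ys \<in> lists I" "zs \<in> lists I" using Cons J zs lists_mono_I by auto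
    have eq: "el (i # ys) = s i \<cdot> el zs" using I zs by (simp add: el_Cons)
    show ?case
    proof (cases "len (s i \<cdot> el zs) < len (el zs)")
      case True
      then obtain k where k: "k < length zs" "s i \<cdot> el zs = el (take k zs @ drop (Suc k) zs)"
        using exchange[of zs i] I by auto
      have "length zs = Suc (len (s i \<cdot> el zs))"
        using zs(2) len_s_mul_cases[of i "el zs"] I True by (simp add: reduced_def)
      moreover have "length (take k zs @ drop (Suc k) zs) = length zs - 1" using k(1) by simp
      ultimately have "length (take k zs @ drop (Suc k) zs) \<le> len (el (take k zs @ drop (Suc k) zs))"
        unfolding k(2) by linarith
      then have "reduced (take k zs @ drop (Suc k) zs)" using I by (intro reduced_if_length_le) simp_all
      moreover have "take k zs @ drop (Suc k) zs \<in> lists J" using zs(1) by simp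
      ultimately show ?thesis using k(2) eq by metis
    next
      case False
      then have "reduced (i # zs)"
        using len_s_mul_cases[of i "el zs"] I zs by (auto simp: reduced_def el_Cons)
      moreover have "i # zs \<in> lists J" using zs(1) I by simp
      ultimately show ?thesis using eq el_Cons I by metis
    qed
  qed
  then obtain zs where zs: "zs \<in> lists J" "reduced zs" "el zs = w"
    using w unfolding parabolic_eq[OF J] by blast
  then have "set xs = set zs" using hecke_cong_set matsumoto xs by blast
  then show ?thesis using zs(1) by (simp add: in_lists_conv_set)
qed

lemma obtain_reduced_parabolic:
  assumes "J \<subseteq> I" "w \<in> P J"
  obtains xs where "reduced xs" "xs \<in> lists J" "el xs = w"
  using assms by (metis obtain_reduced parabolic_carrier parabolic_reduced)

lemma descent_in_parabolic:
  assumes "J \<subseteq> I" "w \<in> P J" "i \<in> I" "len (s i \<cdot> w) < len w"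
  shows "i \<in> J"
proof -
  obtain xs where "reduced (i # xs)" "el (i # xs) = w"
    using descent_obtain_reduced assms parabolic_carrier by metis
  then show ?thesis using parabolic_reduced[OF assms(1,2), of "i # xs"] by auto
qed

lemma len_s_mul_outside_parabolic:
  assumes "J \<subseteq> I" "w \<in> P J" "i \<in> I" "i \<notin> J"
  shows "len (s i \<cdot> w) = Suc (len w)"
  using assms descent_in_parabolic len_s_mul_cases parabolic_carrier by (metis lessI)

lemma s_star_parabolic:
  assumes "J \<subseteq> I" "j \<in> J" "w \<in> P J" shows "s j \<star> w \<in> P J"
proof -
  have "j \<in> I" "w \<in> carrier G" "s j \<cdot> w \<in> P J"
    using assms parabolic_carrier mul_parabolic s_parabolic by blast+
  then show ?thesis using assms(3) by (simp add: s_star)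
qed

lemma hecke_elt_parabolic:
  assumes "J \<subseteq> I" "xs \<in> lists J" shows "hecke_elt xs \<in> P J"
  using assms(2)
proof (induction xs)
  case Nil
  then show ?case using one_parabolic[OF assms(1)] by simp
next
  case (Cons i xs)
  then show ?case
    using hecke_elt_Cons[of i xs] s_star_parabolic[OF assms(1)] assms(1) lists_mono_I[of J xs] by auto
qed

lemma obtain_hecke_elt_parabolic:
  assumes "J \<subseteq> I" "w \<in> P J"
  obtains xs where "xs \<in> lists J" "w = hecke_elt xs"
  using assms by (metis obtain_reduced_parabolic hecke_elt_reduced)

lemma star_absorb_left:
  assumes "J \<subseteq> I" "w \<in> carrier G" "\<And>j. j \<in> J \<Longrightarrow> s j \<star> w = w" "v \<in> P J"
  shows "v \<star> w = w"
proof -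
  obtain xs where xs: "xs \<in> lists J" "v = hecke_elt xs" using obtain_hecke_elt_parabolic assms by metis
  have "hecke_elt xs \<star> w = w" using xs(1)
  proof (induction xs)
    case (Cons i xs)
    then have "i \<in> I" "xs \<in> lists I" using assms(1) lists_mono_I by auto
    then show ?case using Cons assms by (simp add: hecke_elt_Cons star_assoc)
  qed (use assms in simp)
  then show ?thesis using xs by simp
qed

lemma star_absorb_right:
  assumes "J \<subseteq> I" "w \<in> carrier G" "\<And>j. j \<in> J \<Longrightarrow> w \<star> s j = w" "v \<in> P J"
  shows "w \<star> v = w"
proof -
  obtain xs where xs: "xs \<in> lists J" "v = hecke_elt xs" using obtain_hecke_elt_parabolic assms by metis
  have "w \<star> hecke_elt xs = w" using xs(1)
  proof (induction xs)
    case (Cons i xs)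
    then have "i \<in> I" "xs \<in> lists I" using assms(1) lists_mono_I by auto
    then show ?case using Cons assms by (simp add: hecke_elt_Cons flip: star_assoc)
  qed (use assms in simp)
  then show ?thesis using xs by simp
qed

section \<open>Minimal coset representatives\<close>

text \<open>If prepending \<open>i\<close> shortened the product, exchange would delete a letter of
  \<open>xs\<close>, against reducedness of \<open>i # xs\<close>, or a letter of \<open>ys\<close>,
  against minimality of \<open>v\<close> in its coset.\<close>

lemma len_mul_minimal:
  assumes J: "J \<subseteq> I" and v: "v \<in> carrier G" and min: "\<And>a. a \<in> P J \<Longrightarrow> len v \<le> len (a \<cdot> v)"
    and a: "a \<in> P J"
  shows "len (a \<cdot> v) = len a + len v"
proof -
  obtain ys where ys: "reduced ys" "el ys = v" using obtain_reduced v by blast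
  have ysI: "ys \<in> lists I" using ys by auto
  have "len (el xs \<cdot> v) = length xs + len v" if "reduced xs" "xs \<in> lists J" for xs
    using that
  proof (induction xs)
    case Nil
    then show ?case using v by simp
  next
    case (Cons i xs)
    have red: "reduced xs" using Cons.prems(1) reduced_Cons by blast
    have I: "i \<in> J" "i \<in> I" "xs \<in> lists J" "xs \<in> lists I" using Cons.prems J lists_mono_I by auto
    have IH: "len (el xs \<cdot> v) = length xs + len v" using Cons.IH red I by blast
    have el: "el (xs @ ys) = el xs \<cdot> v" using I ys ysI by (simp add: el_append)
    have "\<not> len (s i \<cdot> (el xs \<cdot> v)) < len (el xs \<cdot> v)"
    proof
      assume "len (s i \<cdot> (el xs \<cdot> v)) < len (el xs \<cdot> v)"
      then obtain k where k: "k < length (xs @ ys)"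
        "s i \<cdot> el (xs @ ys) = el (take k (xs @ ys) @ drop (Suc k) (xs @ ys))"
        using exchange[of "xs @ ys" i] I ysI el by auto
      show False
      proof (cases "k < length xs")
        case True
        let ?zs = "take k xs @ drop (Suc k) xs"
        have "s i \<cdot> el xs \<cdot> v = el ?zs \<cdot> v"
          using k(2) True I ysI ys v by (simp add: el_append G.m_assoc)
        then have "el (i # xs) = el ?zs" using I v by (simp add: el_Cons)
        then have "length (i # xs) \<le> length ?zs"
          using Cons.prems(1) len_el_le[of ?zs] I by (simp add: reduced_def)
        then show False using True by simp
      next
        case False
        let ?zs = "take (k - length xs) ys @ drop (Suc (k - length xs)) ys"
        have "s i \<cdot> (el xs \<cdot> v) = el xs \<cdot> el ?zs"
          using k(2) append_take_drop_delete[of xs k ys] False I ysI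
          by (simp only: el) (simp add: el_append)
        \<comment> \<open>The deletion multiplies \<open>v\<close> on the left by a conjugate of
          \<open>s i\<close> lying in \<open>P J\<close>, so the shorter word stays in the
          coset.\<close>
        then have "el ?zs = inv\<^bsub>G\<^esub> el xs \<cdot> (s i \<cdot> (el xs \<cdot> v))"
          using I ysI v by (simp add: G.inv_solve_left)
        then have "el ?zs = (inv\<^bsub>G\<^esub> el xs \<cdot> s i \<cdot> el xs) \<cdot> v" using I v by (simp add: G.m_assoc)
        moreover have "inv\<^bsub>G\<^esub> el xs \<cdot> s i \<cdot> el xs \<in> P J"
          using I J by (intro mul_parabolic inv_parabolic s_parabolic) (auto simp: parabolic_eq)
        ultimately have "len v \<le> len (el ?zs)" using min by simp
        then show False using len_el_le[of ?zs] False k(1) ys ysI by (auto simp: reduced_def)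
      qed
    qed
    then show ?case
      using len_s_mul_cases[of i "el xs \<cdot> v"] IH I v by (simp add: el_Cons G.m_assoc)
  qed
  moreover obtain xs where "reduced xs" "xs \<in> lists J" "el xs = a"
    using obtain_reduced_parabolic J a by blast
  ultimately show ?thesis by (metis reduced_def)
qed

text \<open>A local condition for minimality: write \<open>v = c \<cdot> (b \<cdot> v)\<close> with
  \<open>b \<cdot> v\<close> minimal in the coset. Were \<open>c\<close> nontrivial, the first
  letter of a reduced word of \<open>c\<close> would be a descent of \<open>v\<close>.\<close>

lemma len_mul_no_descent:
  assumes J: "J \<subseteq> I" and v: "v \<in> carrier G" and asc: "\<And>j. j \<in> J \<Longrightarrow> len v < len (s j \<cdot> v)"
    and a: "a \<in> P J"
  shows "len (a \<cdot> v) = len a + len v"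
proof -
  obtain b where b: "b \<in> P J" and le: "\<And>a. a \<in> P J \<Longrightarrow> len (b \<cdot> v) \<le> len (a \<cdot> v)"
    using ex_has_least_nat[of "\<lambda>b. b \<in> P J" "\<one>\<^bsub>G\<^esub>" "\<lambda>b. len (b \<cdot> v)"] one_parabolic[OF J] by blast
  have bG: "b \<in> carrier G" using b J parabolic_carrier by blast
  have min: "len (b \<cdot> v) \<le> len (a \<cdot> (b \<cdot> v))" if "a \<in> P J" for a
    using le[of "a \<cdot> b"] mul_parabolic[OF that b] that J v bG parabolic_carrier by (simp add: G.m_assoc)
  have add: "len (a \<cdot> (b \<cdot> v)) = len a + len (b \<cdot> v)" if "a \<in> P J" for a
    by (rule len_mul_minimal[OF J _ min that]) (use bG v in auto)
  define c where "c = inv\<^bsub>G\<^esub> b"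
  have c: "c \<in> P J" "c \<in> carrier G" using inv_parabolic J b bG by (auto simp: c_def)
  have cv: "c \<cdot> (b \<cdot> v) = v" using bG v by (simp add: c_def flip: G.m_assoc)
  have "len c = 0"
  proof (rule ccontr)
    assume "len c \<noteq> 0"
    obtain xs where xs: "reduced xs" "xs \<in> lists J" "el xs = c" using obtain_reduced_parabolic J c by blast
    then obtain i ys where i: "xs = i # ys" using \<open>len c \<noteq> 0\<close> by (cases xs) auto
    then have I: "i \<in> J" "ys \<in> lists J" "i \<in> I" "ys \<in> lists I" using xs J lists_mono_I by auto
    have ys: "s i \<cdot> c = el ys" using xs(3) I i by (auto simp: el_Cons)
    have "len (el ys) < len c" using xs i len_el_le[of ys] I by (auto simp: reduced_def)
    moreover have "s i \<cdot> v = el ys \<cdot> (b \<cdot> v)"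
      using cv ys bG c v I by (metis G.m_assoc G.m_closed s_closed)
    moreover have "len (el ys \<cdot> (b \<cdot> v)) = len (el ys) + len (b \<cdot> v)" "len v = len c + len (b \<cdot> v)"
      using add[of "el ys"] add[of c] c cv I J by (auto simp: parabolic_eq)
    ultimately show False using asc[OF I(1)] by simp
  qed
  then have "c = \<one>\<^bsub>G\<^esub>" using c len_eq_0 by blast
  then show ?thesis using add[OF a] bG v cv by simp
qed

section \<open>The parabolic projection\<close>

text \<open>Deleting the letters outside \<open>J\<close> respects the Hecke relations: the braid relation of \<open>i \<in> J\<close>
  and \<open>j \<notin> J\<close> becomes an equation between two nonempty powers of \<open>i\<close>.\<close>

lemma filter_alternating_cong:
  assumes "i \<in> I" "Q i" "\<not> Q j" "0 < n"
  shows "hecke_cong (filter Q (alternating_word i j n)) [i]"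
  using assms(4)
proof (induction n rule: less_induct)
  case (less n)
  consider "n = 1" | "n = 2" | k where "n = Suc (Suc k)" "0 < k"
    using less.prems by (metis One_nat_def Suc_1 gr0_conv_Suc neq0_conv)
  then show ?case
  proof cases
    case (3 k)
    then have "hecke_cong (i # filter Q (alternating_word i j k)) (i # [i])"
      using less.IH[of k] assms by (intro word_cong_Cons) auto
    then show ?thesis
      using 3 assms hecke_cong_idem[of i "[]" "[]"] by (auto intro: word_cong.trans)
  qed (use assms in \<open>auto simp: numeral_2_eq_2 intro: word_cong.refl\<close>)
qed

lemma filter_braid_cong:
  assumes "i \<in> I" "j \<in> I" "i \<noteq> j" "M i j = enat m"
  shows "hecke_cong (filter Q (alternating_word i j m)) (filter Q (alternating_word j i m))"
proof -
  \<comment> \<open>When the leading letter is deleted by the filter, \<open>n\<close> letters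
    remain, and \<open>0 < n\<close> guarantees that the other generator is among them.\<close>
  obtain n where n: "m = Suc n" "0 < n" using M_enat_ge_2[OF assms] by (cases m) auto
  consider "Q i" "Q j" | "Q i" "\<not> Q j" | "\<not> Q i" "Q j" | "\<not> Q i" "\<not> Q j" by blast
  then show ?thesis
  proof cases
    case 1
    have "filter Q (alternating_word a b k) = alternating_word a b k" if "{a, b} = {i, j}" for a b k
      using that 1 alternating_word_in_lists[of a "{i, j}" b k]
      by (intro filter_True) (auto simp: in_lists_conv_set doubleton_eq_iff)
    then have f: "filter Q (alternating_word i j m) = alternating_word i j m"
      "filter Q (alternating_word j i m) = alternating_word j i m" by auto
    show ?thesis unfolding f using hecke_cong_braid[OF assms, of "[]"] by simp
  next
    case 2
    then have "hecke_cong (filter Q (alternating_word i j m)) [i]"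
      "hecke_cong (filter Q (alternating_word j i m)) [i]"
      using filter_alternating_cong[of i Q j m] filter_alternating_cong[of i Q j n] assms n by auto
    then show ?thesis by (meson word_cong.sym word_cong.trans)
  next
    case 3
    then have "hecke_cong (filter Q (alternating_word i j m)) [j]"
      "hecke_cong (filter Q (alternating_word j i m)) [j]"
      using filter_alternating_cong[of j Q i m] filter_alternating_cong[of j Q i n] assms n by auto
    then show ?thesis by (meson word_cong.sym word_cong.trans)
  next
    case 4
    have "filter Q (alternating_word a b k) = []" if "{a, b} = {i, j}" for a b k
      using that 4 alternating_word_in_lists[of a "{i, j}" b k]
      by (intro filter_False) (auto simp: in_lists_conv_set doubleton_eq_iff)
    then have f: "filter Q (alternating_word i j m) = []"
      "filter Q (alternating_word j i m) = []" by auto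
    show ?thesis unfolding f by (simp add: word_cong.refl)
  qed
qed

lemma filter_in_lists: "xs \<in> lists I \<Longrightarrow> filter Q xs \<in> lists I"
  by (auto simp: in_lists_conv_set)

lemma hecke_cong_filter:
  assumes "hecke_cong xs ys" shows "hecke_cong (filter Q xs) (filter Q ys)"
  using assms
proof (induction rule: word_cong.induct)
  case (rel u v xs ys)
  consider i where "u = [i, i]" "v = [i]" "i \<in> I"
    | i j m where "u = alternating_word i j m" "v = alternating_word j i m" "i \<in> I" "j \<in> I" "i \<noteq> j" "M i j = enat m"
    using rel(1) unfolding hecke_relations_def by blast
  then have "hecke_cong (filter Q u) (filter Q v)"
  proof cases
    case 1
    then show ?thesis using hecke_cong_idem[of i "[]" "[]"] by (auto intro: word_cong.refl)
  next
    case (2 i j m)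
    then show ?thesis using filter_braid_cong by blast
  qed
  then show ?case
    using word_cong_append_left[OF word_cong_append_right, of I _ "filter Q u" "filter Q v" "filter Q ys" "filter Q xs"]
      rel filter_in_lists by simp
qed (auto intro: word_cong.refl word_cong.sym word_cong.trans filter_in_lists)

section \<open>The projection as a function on the group\<close>

text \<open>The choice of word is harmless by \<open>hecke_cong_filter\<close>. The value
  \<open>undefined\<close> outside the group is the one that \<open>extensional\<close>
  prescribes.\<close>

definition project :: "'i set \<Rightarrow> 'i list set \<Rightarrow> 'i list set" where
  "project J w = (if w \<in> carrier G
    then hecke_elt (filter (\<lambda>i. i \<in> J) (SOME xs. xs \<in> lists I \<and> hecke_elt xs = w)) else undefined)"

lemma project_hecke_elt:
  assumes "xs \<in> lists I"
  shows "project J (hecke_elt xs) = hecke_elt (filter (\<lambda>i. i \<in> J) xs)"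
proof -
  define ys where "ys = (SOME ys. ys \<in> lists I \<and> hecke_elt ys = hecke_elt xs)"
  have "ys \<in> lists I \<and> hecke_elt ys = hecke_elt xs"
    unfolding ys_def by (rule someI[of _ xs]) (use assms in simp)
  then have "hecke_cong ys xs" using hecke_elt_eq_iff assms by blast
  then have "hecke_elt (filter (\<lambda>i. i \<in> J) ys) = hecke_elt (filter (\<lambda>i. i \<in> J) xs)"
    by (intro hecke_elt_cong hecke_cong_filter)
  then show ?thesis using assms by (simp add: project_def ys_def)
qed

lemma filter_in_lists_set: "J \<subseteq> I \<Longrightarrow> xs \<in> lists I \<Longrightarrow> filter (\<lambda>i. i \<in> J) xs \<in> lists J"
  by (auto simp: in_lists_conv_set)

lemma project_parabolic: "J \<subseteq> I \<Longrightarrow> w \<in> carrier G \<Longrightarrow> project J w \<in> P J"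
  by (metis obtain_hecke_elt project_hecke_elt hecke_elt_parabolic filter_in_lists_set)

lemma project_star:
  assumes "v \<in> carrier G" "w \<in> carrier G"
  shows "project J (v \<star> w) = project J v \<star> project J w"
proof -
  obtain xs ys where "xs \<in> lists I" "v = hecke_elt xs" "ys \<in> lists I" "w = hecke_elt ys"
    using obtain_hecke_elt assms by metis
  then show ?thesis
    by (simp add: project_hecke_elt filter_in_lists hecke_elt_append[symmetric])
qed

lemma project_s: "i \<in> I \<Longrightarrow> project J (s i) = (if i \<in> J then s i else \<one>\<^bsub>G\<^esub>)"
  using project_hecke_elt[of "[i]" J] by (simp add: hecke_elt_singleton)

lemma project_one: "project J \<one>\<^bsub>G\<^esub> = \<one>\<^bsub>G\<^esub>"
  using project_hecke_elt[of "[]" J] by simp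

lemma project_unital_hom:
  "J \<subseteq> I \<Longrightarrow> project J \<in> unital_hom H (hecke_submonoid I M J)"
  by (auto simp: unital_hom_def hom_def hecke_submonoid_def project_parabolic project_star project_one)

text \<open>Uniqueness holds because every element is a Hecke product of simple generators, whose
  images are prescribed.\<close>

lemma parabolic_projection_eq:
  assumes J: "J \<subseteq> I" shows "parabolic_projection I M J = project J"
  unfolding parabolic_projection_def
proof (rule the_equality)
  show "project J \<in> extensional (carrier H) \<and> project J \<in> unital_hom H (hecke_submonoid I M J) \<and>
     (\<forall>i\<in>J. project J (s i) = s i) \<and> (\<forall>i\<in>I - J. project J (s i) = \<one>\<^bsub>H\<^esub>)"
  proof (intro conjI ballI)
    show "project J \<in> extensional (carrier H)" by (simp add: extensional_def project_def)
  qed (use J project_unital_hom in \<open>auto simp only: project_s one_H if_True if_False Diff_iff subset_iff\<close>)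
next
  fix p assume p: "p \<in> extensional (carrier H) \<and> p \<in> unital_hom H (hecke_submonoid I M J) \<and>
     (\<forall>i\<in>J. p (s i) = s i) \<and> (\<forall>i\<in>I - J. p (s i) = \<one>\<^bsub>H\<^esub>)"
  have "p (hecke_elt xs) = project J (hecke_elt xs)" if "xs \<in> lists I" for xs
    using that
  proof (induction xs)
    case Nil
    then show ?case using p by (simp add: unital_hom_def hecke_submonoid_def project_one)
  next
    case (Cons i xs)
    then have I: "i \<in> I" "xs \<in> lists I" by auto
    have "p (s i \<star> hecke_elt xs) = p (s i) \<star> p (hecke_elt xs)"
      using p I by (auto simp: unital_hom_def hom_def hecke_submonoid_def)
    moreover have "p (s i) = project J (s i)" using p I by (simp add: project_s)
    ultimately show ?case using Cons I by (simp add: hecke_elt_Cons project_star)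
  qed
  then have "p w = project J w" if "w \<in> carrier G" for w using that obtain_hecke_elt by metis
  moreover have "p w = project J w" if "w \<notin> carrier G" for w
    using that p by (auto simp: extensional_def project_def)
  ultimately show "p = project J" by blast
qed

end

section \<open>Longest elements\<close>

locale finite_coxeter_system = coxeter_system I M
  for I :: "'i set" and M :: "'i \<Rightarrow> 'i \<Rightarrow> enat" +
  assumes finite_type: "finite_type I M"
begin

abbreviation lo where "lo \<equiv> longest_elt I M"

lemma obtain_maximal:
  assumes "J \<subseteq> I"
  obtains w where "w \<in> P J" "\<And>v. v \<in> P J \<Longrightarrow> len v \<le> len w"
proof -
  have "finite (P J)"
    using finite_type parabolic_carrier[OF assms]
    by (auto simp: finite_type_def intro: finite_subset[of "P J" "carrier G"])
  then have fin: "finite (len ` P J)" "len ` P J \<noteq> {}" using one_parabolic[OF assms] by auto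
  then obtain w where "w \<in> P J" "len w = Max (len ` P J)" using Max_in by (metis imageE)
  then show ?thesis using that fin by simp
qed

lemma maximal_star:
  assumes J: "J \<subseteq> I" and w: "w \<in> P J" "\<And>v. v \<in> P J \<Longrightarrow> len v \<le> len w" and j: "j \<in> J"
  shows "s j \<star> w = w" "w \<star> s j = w"
proof -
  have G: "j \<in> I" "w \<in> carrier G" using J w j parabolic_carrier by auto
  have "len (s j \<cdot> w) \<le> len w" "len (w \<cdot> s j) \<le> len w"
    using w mul_parabolic s_parabolic J j by auto
  then show "s j \<star> w = w" "w \<star> s j = w"
    using s_star[OF G] star_s[OF G] len_s_mul_cases[OF G] len_mul_s_cases[OF G] by auto
qed

text \<open>Evaluate \<open>v \<star> w\<close> twice: \<open>v\<close> absorbs \<open>w\<close> on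
  the right, and \<open>w\<close> absorbs \<open>v\<close> on the left. This yields uniqueness of
  the longest element and the criterion \<open>lo_eqI\<close>.\<close>

lemma maximal_eq:
  assumes J: "J \<subseteq> I"
    and v: "v \<in> P J" "\<And>j. j \<in> J \<Longrightarrow> v \<star> s j = v"
    and w: "w \<in> P J" "\<And>j. j \<in> J \<Longrightarrow> s j \<star> w = w"
  shows "v = w"
  using star_absorb_right[OF J _ v(2) w(1)] star_absorb_left[OF J _ w(2) v(1)] parabolic_carrier[OF J] v w
  by simp

lemma lo_eq_maximal:
  assumes J: "J \<subseteq> I" and w: "w \<in> P J" "\<And>v. v \<in> P J \<Longrightarrow> len v \<le> len w"
  shows "lo J = w"
  unfolding longest_elt_def
proof (rule the_equality)
  fix v assume "v \<in> P J \<and> (\<forall>u\<in>P J. len u \<le> len v)"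
  then have v: "v \<in> P J" "\<And>u. u \<in> P J \<Longrightarrow> len u \<le> len v" by blast+
  show "v = w"
    by (rule maximal_eq[OF J v(1) _ w(1)]) (use maximal_star[OF J v] maximal_star[OF J w] in auto)
qed (use w in auto)

lemma lo_parabolic: "J \<subseteq> I \<Longrightarrow> lo J \<in> P J"
  and len_le_lo: "J \<subseteq> I \<Longrightarrow> v \<in> P J \<Longrightarrow> len v \<le> len (lo J)"
  by (metis obtain_maximal lo_eq_maximal)+

lemma lo_closed [simp]: "J \<subseteq> I \<Longrightarrow> lo J \<in> carrier G"
  using lo_parabolic parabolic_carrier by blast

lemma s_star_lo: "J \<subseteq> I \<Longrightarrow> j \<in> J \<Longrightarrow> s j \<star> lo J = lo J"
  and lo_star_s: "J \<subseteq> I \<Longrightarrow> j \<in> J \<Longrightarrow> lo J \<star> s j = lo J"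
  by (rule maximal_star[OF _ lo_parabolic len_le_lo]; assumption)+

lemma lo_eqI: "J \<subseteq> I \<Longrightarrow> v \<in> P J \<Longrightarrow> (\<And>j. j \<in> J \<Longrightarrow> v \<star> s j = v) \<Longrightarrow> v = lo J"
  by (rule maximal_eq) (auto simp: lo_parabolic s_star_lo)

lemma inv_lo [simp]:
  assumes "J \<subseteq> I" shows "inv\<^bsub>G\<^esub> lo J = lo J"
proof (rule lo_eq_maximal[symmetric, OF assms])
  show "inv\<^bsub>G\<^esub> lo J \<in> P J" using inv_parabolic lo_parabolic assms by blast
  show "len v \<le> len (inv\<^bsub>G\<^esub> lo J)" if "v \<in> P J" for v
    using len_le_lo[OF assms that] len_inv[OF lo_closed[OF assms]] by simp
qed

lemma lo_lo: "J \<subseteq> I \<Longrightarrow> lo J \<cdot> lo J = \<one>\<^bsub>G\<^esub>"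
  using G.r_inv[of "lo J"] by simp

lemma lo_lo_mul [simp]: "J \<subseteq> I \<Longrightarrow> w \<in> carrier G \<Longrightarrow> lo J \<cdot> (lo J \<cdot> w) = w"
  by (simp add: lo_lo flip: G.m_assoc)

section \<open>Length complements\<close>

text \<open>As long as \<open>a\<close> is not the longest element, \<open>lo_eqI\<close> provides a
  generator of \<open>J\<close> that lengthens it on the right; the induction is on the missing
  length.\<close>

lemma lo_complement:
  assumes J: "J \<subseteq> I" and a: "a \<in> P J"
  shows "\<exists>b\<in>P J. a \<cdot> b = lo J \<and> len a + len b = len (lo J)"
  using a
proof (induction "len (lo J) - len a" arbitrary: a rule: less_induct)
  case less
  have aG: "a \<in> carrier G" using less.prems J parabolic_carrier by blast
  show ?case
  proof (cases "a = lo J")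
    case True
    then show ?thesis using J one_parabolic by (intro bexI[of _ "\<one>\<^bsub>G\<^esub>"]) auto
  next
    case False
    then obtain j where j: "j \<in> J" "a \<star> s j \<noteq> a" using lo_eqI[OF J less.prems] by blast
    then have jI: "j \<in> I" using J by auto
    have len: "len (a \<cdot> s j) = Suc (len a)"
      using j(2) star_s[OF jI aG] len_mul_s_cases[OF jI aG] by (metis lessI)
    have as: "a \<cdot> s j \<in> P J" using less.prems mul_parabolic s_parabolic J j by auto
    have "len (a \<cdot> s j) \<le> len (lo J)" using len_le_lo[OF J as] .
    then obtain b where b: "b \<in> P J" "a \<cdot> s j \<cdot> b = lo J" "len (a \<cdot> s j) + len b = len (lo J)"
      using less.hyps[OF _ as] len by (metis Suc_le_eq diff_less_mono2 lessI)
    have bG: "b \<in> carrier G" using b J parabolic_carrier by blast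
    have sb: "s j \<cdot> b \<in> P J" "a \<cdot> (s j \<cdot> b) = lo J"
      using b mul_parabolic s_parabolic J j jI aG bG by (auto simp: G.m_assoc)
    \<comment> \<open>Together with the bound \<open>Suc (len b)\<close> for the second summand this
      forces additivity.\<close>
    then have "len (lo J) \<le> len a + len (s j \<cdot> b)" using len_mul_le[of a "s j \<cdot> b"] aG bG jI by simp
    moreover have "len (s j \<cdot> b) \<le> Suc (len b)" using len_s_mul_le jI bG by blast
    ultimately show ?thesis using sb b(3) len by (intro bexI[of _ "s j \<cdot> b"]) auto
  qed
qed

text \<open>The complement of the inverse of \<open>a\<close> is
  \<open>a \<cdot> lo J\<close>.\<close>

lemma len_mul_lo:
  assumes J: "J \<subseteq> I" and a: "a \<in> P J"
  shows "len (a \<cdot> lo J) + len a = len (lo J)"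
proof -
  have aG: "a \<in> carrier G" using a J parabolic_carrier by blast
  obtain b where b: "b \<in> P J" "inv\<^bsub>G\<^esub> a \<cdot> b = lo J" "len (inv\<^bsub>G\<^esub> a) + len b = len (lo J)"
    using lo_complement[OF J inv_parabolic[OF J a]] by blast
  have "b \<in> carrier G" using b J parabolic_carrier by blast
  then have "a \<cdot> lo J = b" using aG unfolding b(2)[symmetric] by (simp flip: G.m_assoc)
  then show ?thesis using b aG by simp
qed

lemma len_lo_mul:
  assumes J: "J \<subseteq> I" and a: "a \<in> P J"
  shows "len (lo J \<cdot> a) + len a = len (lo J)"
proof -
  have aG: "a \<in> carrier G" using a J parabolic_carrier by blast
  have "len (lo J \<cdot> a) = len (inv\<^bsub>G\<^esub> (lo J \<cdot> a))" using aG J by (metis G.m_closed len_inv lo_closed)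
  also have "\<dots> = len (inv\<^bsub>G\<^esub> a \<cdot> lo J)" using aG J by (simp add: G.inv_mult_group)
  finally show ?thesis using len_mul_lo[OF J inv_parabolic[OF J a]] aG by simp
qed

text \<open>Each multiplication by \<open>lo J\<close> complements lengths, so the conjugate has
  length 1 again; as an element of \<open>P J\<close> it is a generator from
  \<open>J\<close>.\<close>

lemma lo_conj_s:
  assumes J: "J \<subseteq> I" and j: "j \<in> J"
  obtains k where "k \<in> J" "lo J \<cdot> s j \<cdot> lo J = s k"
proof -
  have jI: "j \<in> I" using J j by auto
  let ?v = "lo J \<cdot> s j \<cdot> lo J"
  have P: "?v \<in> P J" "s j \<cdot> lo J \<in> P J" using J j by (auto intro!: mul_parabolic lo_parabolic s_parabolic)
  have "len (s j \<cdot> lo J) + len (s j) = len (lo J)" using len_mul_lo J j s_parabolic by blast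
  moreover have "len (lo J \<cdot> (s j \<cdot> lo J)) + len (s j \<cdot> lo J) = len (lo J)" using len_lo_mul J P by blast
  ultimately have "len ?v = 1" using J jI by (simp add: len_s G.m_assoc)
  moreover obtain xs where "reduced xs" "xs \<in> lists J" "el xs = ?v" using obtain_reduced_parabolic J P by blast
  ultimately obtain k where "k \<in> J" "?v = el [k]"
    by (auto simp: reduced_def length_Suc_conv)
  then show ?thesis using that by (simp add: s_eq)
qed

lemma descent_lo_iff:
  assumes "J \<subseteq> I" "i \<in> I" shows "len (s i \<cdot> lo J) < len (lo J) \<longleftrightarrow> i \<in> J"
  using len_mul_lo[OF assms(1) s_parabolic[OF assms(1)], of i] len_s[OF assms(2)]
    descent_in_parabolic[OF assms(1) lo_parabolic[OF assms(1)] assms(2)] by auto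

text \<open>\<open>J\<close> is recovered as the set of left descents of
  \<open>lo J\<close>.\<close>

lemma lo_inj:
  assumes "J \<subseteq> I" "K \<subseteq> I" "lo J = lo K" shows "J = K"
  using assms descent_lo_iff by (metis subset_antisym subsetI subsetD)

section \<open>Projections of the elements \<open>w\<^bsub>K;I\<^esub>\<close>\<close>

abbreviation par where "par \<equiv> par_elt I M"

lemma par_closed [simp]: "J \<subseteq> K \<Longrightarrow> K \<subseteq> I \<Longrightarrow> par J K \<in> carrier G"
  by (simp add: par_elt_def)

text \<open>Multiplication by \<open>lo I\<close> reverses lengths: \<open>s i\<close> lengthens
  \<open>c\<close>, hence shortens \<open>c \<cdot> lo I\<close> and is absorbed.\<close>

lemma s_star_mul_lo:
  assumes "J \<subseteq> I" "c \<in> P J" "i \<in> I" "i \<notin> J"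
  shows "s i \<star> (c \<cdot> lo I) = c \<cdot> lo I"
proof -
  have c: "c \<in> carrier G" using assms parabolic_carrier by blast
  have "len (s i \<cdot> c \<cdot> lo I) + len (s i \<cdot> c) = len (lo I)" "len (c \<cdot> lo I) + len c = len (lo I)"
    using len_mul_lo[of I] c assms by (auto simp: parabolic_I)
  then have "len (s i \<cdot> (c \<cdot> lo I)) < len (c \<cdot> lo I)"
    using len_s_mul_outside_parabolic[OF assms] c assms by (simp add: G.m_assoc)
  then show ?thesis using s_star[of i "c \<cdot> lo I"] c assms by simp
qed

text \<open>Moving \<open>s t\<close> to the left past \<open>lo I\<close> turns it into some
  \<open>s r\<close>. If \<open>r \<in> K\<close>, it also passes \<open>lo K\<close> and emerges as
  \<open>s k\<close>; otherwise it lengthens \<open>lo K\<close>, so the product with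
  \<open>lo I\<close> becomes shorter and \<open>s t\<close> is absorbed.\<close>

lemma par_star_s:
  assumes K: "K \<subseteq> I" and t: "t \<in> I"
  shows "par K I \<star> s t = par K I \<or> (\<exists>k\<in>K. par K I \<star> s t = s k \<star> par K I)"
proof -
  let ?x = "par K I"
  have x: "?x \<in> carrier G" using K by simp
  obtain r where r: "r \<in> I" "lo I \<cdot> s t \<cdot> lo I = s r" using lo_conj_s[of I t] t by auto
  have "lo I \<cdot> s t = s r \<cdot> lo I" using t unfolding r(2)[symmetric] by (simp add: G.m_assoc lo_lo)
  then have xt: "?x \<cdot> s t = lo K \<cdot> s r \<cdot> lo I" using K t r by (simp add: par_elt_def G.m_assoc)
  show ?thesis
  proof (cases "r \<in> K")
    case True
    obtain k where k: "k \<in> K" "lo K \<cdot> s r \<cdot> lo K = s k" using lo_conj_s[OF K True] .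
    then have kI: "k \<in> I" using K by auto
    have "lo K \<cdot> s r = s k \<cdot> lo K" using K r unfolding k(2)[symmetric] by (simp add: G.m_assoc lo_lo)
    then have eq: "?x \<cdot> s t = s k \<cdot> ?x" using xt K kI by (simp add: par_elt_def G.m_assoc)
    \<comment> \<open>Both group products are the same element, so the left and right descent tests
      have the same outcome.\<close>
    have "?x \<star> s t = s k \<star> ?x" using star_s[OF t x] s_star[OF kI x] eq by simp
    then show ?thesis using k by blast
  next
    case False
    have "inv\<^bsub>G\<^esub> (lo K \<cdot> s r) = s r \<cdot> lo K" using K r by (simp add: G.inv_mult_group)
    then have "len (lo K \<cdot> s r) = Suc (len (lo K))"
      using len_s_mul_outside_parabolic[OF K lo_parabolic[OF K] r(1) False] K r
      by (metis G.m_closed len_inv lo_closed s_closed)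
    moreover have "len (lo K \<cdot> s r \<cdot> lo I) + len (lo K \<cdot> s r) = len (lo I)"
      "len (lo K \<cdot> lo I) + len (lo K) = len (lo I)"
      using len_mul_lo[of I] K r by (auto simp: parabolic_I)
    ultimately have "len (?x \<cdot> s t) < len ?x" unfolding xt by (simp add: par_elt_def)
    then show ?thesis using star_s[OF t x] by simp
  qed
qed

text \<open>With \<open>v\<close> the projection of \<open>w\<^bsub>K;I\<^esub>\<close> and \<open>L\<close> its set of left ascents in \<open>J\<close>, the element
  \<open>w\<^sub>L v\<close> is length-additive and absorbs every generator of \<open>W\<^sub>J\<close> on the right, since
  \<open>v \<star> s\<^sub>t\<close> is either \<open>v\<close> or \<open>s\<^sub>k \<star> v\<close> with \<open>k \<in> K\<close>. Hence \<open>w\<^sub>L v = w\<^sub>J\<close>.\<close>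

theorem project_par:
  assumes J: "J \<subseteq> I" and K: "K \<subseteq> I"
  shows "\<exists>L\<subseteq>J \<inter> K. project J (par K I) = par L J"
proof -
  define v where "v = project J (par K I)"
  have x: "par K I \<in> carrier G" using K by simp
  have vP: "v \<in> P J" using project_parabolic J x by (simp add: v_def)
  have v: "v \<in> carrier G" using vP J parabolic_carrier by blast
  define L where "L = {j \<in> J. len v < len (s j \<cdot> v)}"
  have LJ: "L \<subseteq> J" and LI: "L \<subseteq> I" using J by (auto simp: L_def)
  \<comment> \<open>A generator outside \<open>K\<close> is absorbed on the left by
    \<open>par K I\<close>. If it lies in \<open>J\<close>, applying the projection shows that
    \<open>v\<close> absorbs it too, so it cannot be an ascent.\<close>
  have "j \<in> K" if "j \<in> L" for j
  proof (rule ccontr)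
    assume "j \<notin> K"
    have j: "j \<in> J" "j \<in> I" using that J by (auto simp: L_def)
    have "s j \<star> par K I = par K I"
      using s_star_mul_lo[OF K lo_parabolic[OF K] j(2) \<open>j \<notin> K\<close>] by (simp add: par_elt_def)
    then have "project J (s j) \<star> v = v" using project_star[of "s j" "par K I" J] x j by (simp add: v_def)
    then have "s j \<star> v = v" using j by (simp add: project_s)
    then show False using s_star[OF j(2) v] that by (auto simp: L_def)
  qed
  then have LK: "L \<subseteq> K" by blast
  have v_s: "v \<star> s t = v \<or> (\<exists>k\<in>L. v \<star> s t = s k \<star> v)" if "t \<in> J" for t
  proof -
    have t: "t \<in> I" using that J by auto
    have vt: "v \<star> s t = project J (par K I \<star> s t)" using that t x by (simp add: v_def project_star project_s)
    from par_star_s[OF K t] show ?thesis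
    proof (elim disjE bexE)
      assume "par K I \<star> s t = par K I"
      then show ?thesis using vt by (simp add: v_def)
    next
      fix k assume k: "k \<in> K" "par K I \<star> s t = s k \<star> par K I"
      then have kI: "k \<in> I" using K by auto
      have eq: "v \<star> s t = project J (s k) \<star> v" using vt k kI x by (simp add: v_def project_star)
      show ?thesis
      proof (cases "k \<in> L")
        case True
        then have "k \<in> J" using LJ by auto
        then show ?thesis using True eq kI by (auto simp: project_s)
      next
        case False
        \<comment> \<open>Either \<open>k\<close> lies outside \<open>J\<close> and projects to the
          unit, or it is a descent of \<open>v\<close>.\<close>
        then have "project J (s k) \<star> v = v"
          using s_star[OF kI v] len_s_mul_cases[OF kI v] v kI by (auto simp: project_s L_def)
        then show ?thesis using eq by simp
      qed
    qed
  qed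
  have "len (lo L \<cdot> v) = len (lo L) + len v"
    by (rule len_mul_no_descent[OF LI v _ lo_parabolic[OF LI]]) (auto simp: L_def)
  then have star: "lo L \<star> v = lo L \<cdot> v" using star_eq_mul LI v by simp
  have "lo L \<star> v = lo J"
  proof (rule lo_eqI[OF J])
    show "lo L \<star> v \<in> P J"
      unfolding star using lo_parabolic[OF LI] parabolic_mono[OF LJ] vP mul_parabolic by blast
    fix t assume t: "t \<in> J"
    then have tI: "t \<in> I" using J by auto
    have "lo L \<star> v \<star> s t = lo L \<star> (v \<star> s t)" using LI v tI by (simp add: star_assoc)
    also have "\<dots> = lo L \<star> v"
    proof (cases "v \<star> s t = v")
      case False
      then obtain k where k: "k \<in> L" "v \<star> s t = s k \<star> v" using v_s[OF t] by blast
      then have "k \<in> I" using LI by auto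
      then have "lo L \<star> (s k \<star> v) = lo L \<star> s k \<star> v" using LI v by (simp add: star_assoc)
      then show ?thesis using k lo_star_s[OF LI k(1)] by simp
    qed simp
    finally show "lo L \<star> v \<star> s t = lo L \<star> v" .
  qed
  then have "v = lo L \<cdot> lo J" using star LI v by (metis lo_lo_mul)
  then show ?thesis using LJ LK by (auto simp: v_def par_elt_def)
qed

text \<open>Reading a word from the right, letters in \<open>J\<close> accumulate in
  \<open>u\<close>, since lengths add in \<open>u \<cdot> par J I\<close>. Letters outside
  \<open>J\<close> are absorbed, exactly as \<open>filter\<close> deletes them.\<close>

lemma star_par:
  assumes J: "J \<subseteq> I" and w: "w \<in> carrier G"
  shows "w \<star> par J I = project J w \<cdot> par J I"
proof -
  have "hecke_elt xs \<star> par J I = hecke_elt (filter (\<lambda>i. i \<in> J) xs) \<cdot> par J I" if "xs \<in> lists I" for xs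
    using that
  proof (induction xs)
    case Nil
    then show ?case using J by simp
  next
    case (Cons i xs)
    then have I: "i \<in> I" "xs \<in> lists I" by auto
    define u where "u = hecke_elt (filter (\<lambda>i. i \<in> J) xs)"
    have uP: "u \<in> P J" using hecke_elt_parabolic J filter_in_lists_set I by (simp add: u_def)
    have u: "u \<in> carrier G" using uP J parabolic_carrier by blast
    \<comment> \<open>Additivity comes from the complement formula, applied to \<open>a\<close> in
      \<open>P J\<close> and to \<open>a \<cdot> lo J\<close> and \<open>lo J\<close> in the whole
      group.\<close>
    have mul: "a \<star> par J I = a \<cdot> par J I" if "a \<in> P J" for a
    proof (rule star_eq_mul)
      show a: "a \<in> carrier G" using that J parabolic_carrier by blast
      show "len (a \<cdot> par J I) = len a + len (par J I)"
        using len_mul_lo[of I "a \<cdot> lo J"] len_mul_lo[of I "lo J"] len_mul_lo[OF J that] a J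
        by (simp add: parabolic_I par_elt_def G.m_assoc)
    qed (use J in simp)
    have eq: "hecke_elt (i # xs) \<star> par J I = s i \<star> (u \<star> par J I)"
      using Cons I J uP mul by (simp add: hecke_elt_Cons star_assoc u_def)
    show ?case
    proof (cases "i \<in> J")
      case True
      then have "hecke_elt (filter (\<lambda>i. i \<in> J) (i # xs)) = s i \<star> u"
        using I by (simp add: hecke_elt_Cons filter_in_lists u_def)
      then show ?thesis
        using eq mul[of "s i \<star> u"] s_star_parabolic[OF J True uP] I J u by (simp add: star_assoc)
    next
      case False
      have "u \<cdot> par J I = u \<cdot> lo J \<cdot> lo I" using u J by (simp add: par_elt_def G.m_assoc)
      then have "s i \<star> (u \<cdot> par J I) = u \<cdot> par J I"
        using s_star_mul_lo[OF J mul_parabolic[OF uP lo_parabolic[OF J]] I(1) False] by simp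
      then show ?thesis using eq mul[OF uP] False by (simp add: u_def)
    qed
  qed
  moreover obtain xs where "xs \<in> lists I" "w = hecke_elt xs" using obtain_hecke_elt w by metis
  ultimately show ?thesis by (simp add: project_hecke_elt)
qed

text \<open>An anti-automorphism of the Hecke monoid that fixes every \<open>w\<^bsub>J;I\<^esub>\<close>; so these elements commute
  as soon as their products are of the same form.\<close>

definition twist :: "'i list set \<Rightarrow> 'i list set" where
  "twist w = lo I \<cdot> inv\<^bsub>G\<^esub> w \<cdot> lo I"

lemma twist_closed [simp]: "w \<in> carrier G \<Longrightarrow> twist w \<in> carrier G"
  by (simp add: twist_def)

lemma len_twist: "w \<in> carrier G \<Longrightarrow> len (twist w) = len w"
  using len_lo_mul[of I "inv\<^bsub>G\<^esub> w"] len_mul_lo[of I "lo I \<cdot> inv\<^bsub>G\<^esub> w"]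
  by (simp add: parabolic_I twist_def)

lemma twist_mul: "v \<in> carrier G \<Longrightarrow> w \<in> carrier G \<Longrightarrow> twist (v \<cdot> w) = twist w \<cdot> twist v"
  by (simp add: twist_def G.inv_mult_group G.m_assoc)

lemma twist_s:
  assumes "i \<in> I" obtains k where "k \<in> I" "twist (s i) = s k"
  using lo_conj_s[of I i] assms by (auto simp: twist_def)

text \<open>\<open>twist\<close> preserves length and sends \<open>s i\<close> to a simple
  generator, so the left descent test for \<open>w\<close> becomes the right descent test for its
  image.\<close>

lemma twist_s_star:
  assumes "i \<in> I" "w \<in> carrier G"
  shows "twist (s i \<star> w) = twist w \<star> twist (s i)"
proof -
  obtain k where k: "k \<in> I" "twist (s i) = s k" using twist_s assms by blast
  have m: "twist (s i \<cdot> w) = twist w \<cdot> s k" using twist_mul assms k by simp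
  then have "len (twist w \<cdot> s k) = len (s i \<cdot> w)" using len_twist assms by (metis G.m_closed s_closed)
  then show ?thesis
    using s_star[OF assms] star_s[OF k(1), of "twist w"] assms m k(2) len_twist by simp
qed

lemma twist_star:
  assumes "v \<in> carrier G" "w \<in> carrier G"
  shows "twist (v \<star> w) = twist w \<star> twist v"
proof -
  have "twist (hecke_elt xs \<star> w) = twist w \<star> twist (hecke_elt xs)" if "xs \<in> lists I" for xs
    using that
  proof (induction xs)
    case Nil
    have "twist \<one>\<^bsub>G\<^esub> = \<one>\<^bsub>G\<^esub>" by (simp add: twist_def lo_lo)
    then show ?case using assms by simp
  next
    case (Cons i xs)
    then have I: "i \<in> I" "xs \<in> lists I" by auto
    then show ?case using Cons assms(2) by (simp add: hecke_elt_Cons star_assoc twist_s_star)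
  qed
  then show ?thesis using obtain_hecke_elt[OF assms(1)] by metis
qed

lemma twist_par: "J \<subseteq> I \<Longrightarrow> twist (par J I) = par J I"
  by (simp add: twist_def par_elt_def G.inv_mult_group G.m_assoc)

text \<open>\<open>star_par\<close> computes the product in the opposite order, where the two
  factors \<open>lo J\<close> cancel; \<open>twist\<close> then reverses the order and fixes the
  result.\<close>

lemma par_star_par:
  assumes J: "J \<subseteq> I" and K: "K \<subseteq> I" and L: "L \<subseteq> J" "project J (par K I) = par L J"
  shows "par J I \<star> par K I = par L I"
proof -
  have LI: "L \<subseteq> I" using J L by auto
  have "par K I \<star> par J I = par L J \<cdot> par J I" using star_par J K L by simp
  also have "\<dots> = par L I" using J LI by (simp add: par_elt_def G.m_assoc)
  finally have "twist (par K I \<star> par J I) = par L I" using twist_par LI by simp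
  then show ?thesis using twist_star J K twist_par by simp
qed

text \<open>A competing set gives the same element \<open>par L I\<close>; cancelling
  \<open>lo I\<close> and applying \<open>lo_inj\<close> identifies the sets.\<close>

lemma star_set_eq:
  assumes J: "J \<subseteq> I" and K: "K \<subseteq> I" and L: "L \<subseteq> J \<inter> K" "project J (par K I) = par L J"
  shows "star_set I M J K = L"
  unfolding star_set_def
proof (rule the_equality)
  show "L \<subseteq> J \<inter> K \<and> par J I \<star> par K I = par L I" using par_star_par assms by auto
  fix L' assume L': "L' \<subseteq> J \<inter> K \<and> par J I \<star> par K I = par L' I"
  then have "par L' I = par L I" using par_star_par[OF J K _ L(2)] L(1) by simp
  then have "lo L' \<cdot> lo I = lo L \<cdot> lo I" by (simp add: par_elt_def)
  then have "lo L' = lo L" using L' L(1) J by (subst (asm) G.right_cancel) auto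
  moreover have "L' \<subseteq> I" "L \<subseteq> I" using L' L(1) J by auto
  ultimately show "L' = L" using lo_inj by simp
qed

theorem project_par_eq:
  assumes "J \<subseteq> I" "K \<subseteq> I"
  shows "star_set I M J K \<subseteq> J \<and> project J (par K I) = par (star_set I M J K) J"
  using project_par[OF assms] star_set_eq[OF assms] by auto

end

theorem theorem4p48:
  fixes I :: "'i set" and M :: "'i \<Rightarrow> 'i \<Rightarrow> enat" and J :: "'i set"
  assumes "coxeter_matrix I M" and "finite_type I M" and "J \<subseteq> I"
  shows "(\<forall>K. K \<subseteq> I \<longrightarrow>
            parabolic_projection I M J (par_elt I M K I) = par_elt I M (star_set I M J K) J) \<and>
         parabolic_projection I M J ` {par_elt I M K I | K. K \<subseteq> I}
            \<subseteq> {par_elt I M L J | L. L \<subseteq> J} \<and>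
         parabolic_hom I M J (parabolic_projection I M J)"
proof -
  interpret finite_coxeter_system I M
    by unfold_locales (use assms in auto)
  have "project J (par K I) = par (star_set I M J K) J" "star_set I M J K \<subseteq> J" if "K \<subseteq> I" for K
    using project_par_eq[OF assms(3) that] by auto
  then show ?thesis
    unfolding parabolic_hom_def parabolic_projection_eq[OF assms(3)]
    using project_unital_hom[OF assms(3)] by blast
qed

end
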